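(* Let $m = q^2 + q + 1$ for some prime power $q$, and let $n = 11m$. Then there exists an odd, monotone, unbiased voting rule $\Phi : \{-1,1\}^n \to \{-1,1\}$ that is not transitive-symmetric and has winning coalitions of size $\lfloor 1.508\sqrt{n} \rfloor + 5$.
   Context: A voting rule on $n$ voters is a function $\Phi : \{-1,1\}^n \to \{-1,1\}$. It is odd if $\Phi(-x) = -\Phi(x)$ for all $x$, and monotone if $\Phi(x) \ge \Phi(x')$ whenever $x \ge x'$ coordinate-wise. A permutation $\sigma$ of $[n]$ acts on $\{-1,1\}^n$ by permuting coordinates, and on voting rules by $(\sigma\Phi)(x) = \Phi(\sigma^{-1}(x))$; $\mathrm{aut}(\Phi)$ is the group of permutations $\sigma$ with $\sigma\Phi = \Phi$. $\Phi$ is transitive-symmetric if for every $u, v \in [n]$ there is $\sigma \in \mathrm{aut}(\Phi)$ with $\sigma(u) = v$. For $x \in \{-1,1\}^n$ let $x^{\oplus i}$ be $x$ with its $i$-th coordinate negated. For a probability measure $\mu$ on $\{-1,1\}^n$, $\mathbb{I}_i^\mu(\Phi) = \mathbb{P}_{x \sim \mu}[\Phi(x) \ne \Phi(x^{\oplus i})]$. $\Phi$ is unbiased if $\mathbb{I}_1^\mu(\Phi) = \cdots = \mathbb{I}_n^\mu(\Phi)$ for every i.i.d. measure $\mu = p^{\otimes n}$, $p$ a probability measure on $\{-1,1\}$. A winning coalition for $\Phi$ is a set $S \subseteq [n]$ such that for each $y \in \{-1,1\}$, whenever $x_i = y$ for all $i \in S$, then $\Phi(x) = y$. *)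

theory Defs
  imports "HOL-Probability.Probability" "HOL-Number_Theory.Prime_Powers"
    "HOL-Combinatorics.Permutations"
begin

text \<open>
  The voters are \<open>{1..n}\<close>. A point of the cube is a function that is \<open>undefined\<close> off
  \<open>{1..n}\<close>, so that equality of points is equality of functions. Every condition on a voting
  rule only looks at its values on the cube.
\<close>

definition cube :: "nat \<Rightarrow> (nat \<Rightarrow> int) set" where
  "cube n = {1..n} \<rightarrow>\<^sub>E {-1, 1}"

definition voting_rule :: "nat \<Rightarrow> ((nat \<Rightarrow> int) \<Rightarrow> int) \<Rightarrow> bool" where
  "voting_rule n \<Phi> \<longleftrightarrow> \<Phi> \<in> cube n \<rightarrow> {-1, 1}"

definition cube_neg :: "nat \<Rightarrow> (nat \<Rightarrow> int) \<Rightarrow> (nat \<Rightarrow> int)" where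
  "cube_neg n x = (\<lambda>i\<in>{1..n}. - x i)"

definition odd_rule :: "nat \<Rightarrow> ((nat \<Rightarrow> int) \<Rightarrow> int) \<Rightarrow> bool" where
  "odd_rule n \<Phi> \<longleftrightarrow> (\<forall>x\<in>cube n. \<Phi> (cube_neg n x) = - \<Phi> x)"

definition monotone_rule :: "nat \<Rightarrow> ((nat \<Rightarrow> int) \<Rightarrow> int) \<Rightarrow> bool" where
  "monotone_rule n \<Phi> \<longleftrightarrow>
    (\<forall>x\<in>cube n. \<forall>x'\<in>cube n. (\<forall>i\<in>{1..n}. x i \<ge> x' i) \<longrightarrow> \<Phi> x \<ge> \<Phi> x')"

text \<open>
  A permutation moves the entry at coordinate \<open>i\<close> to coordinate \<open>\<sigma> i\<close> (a left action). Since
  \<open>\<sigma> permutes {1..n}\<close> fixes every index off \<open>{1..n}\<close>, it maps the cube to itself.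
\<close>

definition perm_point :: "(nat \<Rightarrow> nat) \<Rightarrow> (nat \<Rightarrow> int) \<Rightarrow> (nat \<Rightarrow> int)" where
  "perm_point \<sigma> x = x \<circ> inv \<sigma>"

definition perm_rule ::
    "(nat \<Rightarrow> nat) \<Rightarrow> ((nat \<Rightarrow> int) \<Rightarrow> int) \<Rightarrow> ((nat \<Rightarrow> int) \<Rightarrow> int)" where
  "perm_rule \<sigma> \<Phi> = (\<lambda>x. \<Phi> (perm_point (inv \<sigma>) x))"

definition aut :: "nat \<Rightarrow> ((nat \<Rightarrow> int) \<Rightarrow> int) \<Rightarrow> (nat \<Rightarrow> nat) set" where
  "aut n \<Phi> = {\<sigma>. \<sigma> permutes {1..n} \<and> (\<forall>x\<in>cube n. perm_rule \<sigma> \<Phi> x = \<Phi> x)}"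

definition transitive_symmetric :: "nat \<Rightarrow> ((nat \<Rightarrow> int) \<Rightarrow> int) \<Rightarrow> bool" where
  "transitive_symmetric n \<Phi> \<longleftrightarrow> (\<forall>u\<in>{1..n}. \<forall>v\<in>{1..n}. \<exists>\<sigma>\<in>aut n \<Phi>. \<sigma> u = v)"

definition flip :: "nat \<Rightarrow> (nat \<Rightarrow> int) \<Rightarrow> (nat \<Rightarrow> int)" where
  "flip i x = x(i := - x i)"

definition influence :: "(nat \<Rightarrow> int) pmf \<Rightarrow> nat \<Rightarrow> ((nat \<Rightarrow> int) \<Rightarrow> int) \<Rightarrow> real" where
  "influence \<mu> i \<Phi> = measure_pmf.prob \<mu> {x. \<Phi> x \<noteq> \<Phi> (flip i x)}"

text \<open>The default value \<open>undefined\<close> makes the product measure live on \<open>cube n\<close>.\<close>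

definition iid_measure :: "nat \<Rightarrow> int pmf \<Rightarrow> (nat \<Rightarrow> int) pmf" where
  "iid_measure n p = Pi_pmf {1..n} undefined (\<lambda>_. p)"

definition unbiased :: "nat \<Rightarrow> ((nat \<Rightarrow> int) \<Rightarrow> int) \<Rightarrow> bool" where
  "unbiased n \<Phi> \<longleftrightarrow>
    (\<forall>p. set_pmf p \<subseteq> {-1, 1} \<longrightarrow>
      (\<forall>i\<in>{1..n}. \<forall>j\<in>{1..n}.
        influence (iid_measure n p) i \<Phi> = influence (iid_measure n p) j \<Phi>))"

definition winning_coalition :: "nat \<Rightarrow> ((nat \<Rightarrow> int) \<Rightarrow> int) \<Rightarrow> nat set \<Rightarrow> bool" where
  "winning_coalition n \<Phi> S \<longleftrightarrow>
    S \<subseteq> {1..n} \<and> (\<forall>y\<in>{-1, 1}. \<forall>x\<in>cube n. (\<forall>i\<in>S. x i = y) \<longrightarrow> \<Phi> x = y)"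

end

theory Submission
  imports "HOL-Algebra.Algebraic_Closure" "HOL-Number_Theory.Residues" Defs
begin

text \<open>
  The voters are \<open>P \<times> {0..10}\<close>, where \<open>P\<close> is the set of points of the projective plane of order
  \<open>q\<close>. The quadratic residues \<open>R = {1, 3, 4, 5, 9}\<close> modulo 11 form a difference set, so any two of the sets
  \<open>l \<times> (R + t)\<close> with \<open>l\<close> a line meet; they have \<open>5 (q + 1)\<close> elements, and \<open>5 < 1.508 \<surd>11\<close>. Majority
  overridden by these coalitions is invariant under a transitive group.

  To destroy the symmetry without changing the influences, a family \<open>\<S>\<close> of losing sets with
  \<open>(n - 1) / 2\<close> elements is declared winning (and the complements losing). A rule given by an upward
  closed family \<open>W\<close> is unbiased as soon as every voter lies in equally many members of \<open>W\<close> of each size,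
  so it suffices that \<open>\<S>\<close> is regular. Every member of \<open>\<S>\<close> meets the fibre over a point \<open>c\<close> in a
  cyclic interval of length 5 or 6, except over one special point, where other shapes with the same
  counts are used. In an interval a single voter can be exchanged for another one; over the special
  point the shapes differ too much for this, and automorphisms cannot mix the two kinds of voters.
  The special shapes also pairwise meet, which makes \<open>\<S>\<close> intersecting and the rule monotone.
\<close>

section \<open>Finite fields\<close>

lemma (in cring) binomial_expansion:
  assumes x: "x \<in> carrier R" and y: "y \<in> carrier R"
  shows "(x \<oplus> y) [^] (n::nat) = (\<Oplus>k\<in>{..n}. [(n choose k)] \<cdot> (x [^] k \<otimes> y [^] (n - k)))"
proof (induction n)
  case 0
  show ?case using x y by (simp add: finsum_0)
next
  case (Suc n)
  let ?t = "\<lambda>n k. [(n choose k)] \<cdot> (x [^] k \<otimes> y [^] (n - k))"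
  let ?u = "\<lambda>k. x [^] Suc k \<otimes> y [^] (n - k)"
  have "(x \<oplus> y) [^] Suc n = (\<Oplus>k\<in>{..n}. ?t n k) \<otimes> x \<oplus> (\<Oplus>k\<in>{..n}. ?t n k) \<otimes> y"
    using x y by (simp add: Suc.IH r_distr)
  also have "(\<Oplus>k\<in>{..n}. ?t n k) \<otimes> x = (\<Oplus>k\<in>{..n}. ?t n k \<otimes> x)"
    using x y by (intro finsum_ldistr) auto
  also have "\<dots> = (\<Oplus>k\<in>{..n}. [(n choose k)] \<cdot> ?u k)"
    using x y by (intro finsum_cong') (auto simp: add_pow_ldistr add_pow_rdistr m_ac nat_pow_Suc)
  also have "(\<Oplus>k\<in>{..n}. ?t n k) \<otimes> y = (\<Oplus>k\<in>{..n}. ?t n k \<otimes> y)"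
    using x y by (intro finsum_ldistr) auto
  also have "\<dots> = (\<Oplus>k\<in>{..n}. [(n choose k)] \<cdot> (x [^] k \<otimes> y [^] (Suc n - k)))"
    using x y by (intro finsum_cong') (auto simp: add_pow_ldistr add_pow_rdistr m_ac nat_pow_Suc Suc_diff_le)
  \<comment> \<open>The added summand \<open>k = Suc n\<close> vanishes because
    \<open>n choose Suc n = 0\<close>. Splitting off \<open>k = 0\<close> next leaves the monomials
    \<open>?u k\<close> in both sums, ready for Pascal's rule.\<close>
  also have "\<dots> = (\<Oplus>k\<in>{..Suc n}. [(n choose k)] \<cdot> (x [^] k \<otimes> y [^] (Suc n - k)))"
    using x y by (subst finsum_Suc) (auto simp: binomial_eq_0 add.nat_pow_0 simp del: nat_pow_Suc)
  also have "\<dots> = (\<Oplus>k\<in>{..n}. [(n choose Suc k)] \<cdot> ?u k) \<oplus> y [^] Suc n"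
    using x y by (subst finsum_Suc2) auto
  also have "(\<Oplus>k\<in>{..n}. [(n choose k)] \<cdot> ?u k) \<oplus>
      ((\<Oplus>k\<in>{..n}. [(n choose Suc k)] \<cdot> ?u k) \<oplus> y [^] Suc n) =
      (\<Oplus>k\<in>{..n}. [(n choose k)] \<cdot> ?u k \<oplus> [(n choose Suc k)] \<cdot> ?u k) \<oplus> y [^] Suc n"
    using x y by (subst finsum_addf) (auto simp: a_assoc finsum_closed)
  also have "\<dots> = (\<Oplus>k\<in>{..n}. [(Suc n choose Suc k)] \<cdot> ?u k) \<oplus> y [^] Suc n"
  proof (intro arg_cong2[where f = "(\<oplus>)"] finsum_cong' refl)
    fix k assume "k \<in> {..n}"
    show "[(n choose k)] \<cdot> ?u k \<oplus> [(n choose Suc k)] \<cdot> ?u k = [(Suc n choose Suc k)] \<cdot> ?u k"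
      using x y by (simp add: add.nat_pow_mult)
  qed (use x y in auto)
  also have "\<dots> = (\<Oplus>k\<in>{..Suc n}. ?t (Suc n) k)"
    using x y by (subst finsum_Suc2) auto
  finally show ?case .
qed

text \<open>The prime \<open>p\<close> divides every binomial coefficient strictly between the ends,
  so only the two end terms survive; iterating gives the powers of \<open>p\<close>.\<close>

lemma (in cring) frobenius_add:
  fixes p k :: nat
  assumes p: "prime p" and char: "[p] \<cdot> \<one> = \<zero>"
    and x: "x \<in> carrier R" and y: "y \<in> carrier R"
  shows "(x \<oplus> y) [^] (p ^ k) = x [^] (p ^ k) \<oplus> y [^] (p ^ k)"
proof -
  have step: "(a \<oplus> b) [^] p = a [^] p \<oplus> b [^] p"
    if a: "a \<in> carrier R" and b: "b \<in> carrier R" for a b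
  proof -
    \<comment> \<open>With two successors visible, the end terms \<open>p\<close> and
      \<open>0\<close> can be split off; the middle terms have index \<open>Suc k\<close> with
      \<open>k \<le> r\<close>.\<close>
    obtain r where r: "p = Suc (Suc r)"
      using that[of "p - 2"] prime_ge_2_nat[OF p] by simp
    have mid: "[(p choose Suc k)] \<cdot> (a [^] Suc k \<otimes> b [^] (p - Suc k)) = \<zero>" if "k \<le> r" for k
    proof -
      have "p dvd p choose Suc k"
        using p that by (intro dvd_choose_prime) (auto simp: r)
      then obtain c where c: "p choose Suc k = p * c" by (auto elim: dvdE)
      let ?z = "a [^] Suc k \<otimes> b [^] (p - Suc k)"
      have z: "?z \<in> carrier R" using a b by auto
      have "[(p * c)] \<cdot> ?z = [c] \<cdot> ([p] \<cdot> (\<one> \<otimes> ?z))"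
        using z by (simp add: add.nat_pow_pow mult.commute)
      also have "[p] \<cdot> (\<one> \<otimes> ?z) = ([p] \<cdot> \<one>) \<otimes> ?z"
        using z by (simp only: add_pow_ldistr one_closed)
      also have "\<dots> = \<zero>" using z char by simp
      finally show ?thesis by (simp add: c)
    qed
    let ?t = "\<lambda>k. [(p choose k)] \<cdot> (a [^] k \<otimes> b [^] (p - k))"
    have "(a \<oplus> b) [^] p = (\<Oplus>k\<in>{..Suc (Suc r)}. ?t k)"
      using binomial_expansion[OF a b, of p] by (simp only: r)
    also have "\<dots> = ?t p \<oplus> ((\<Oplus>k\<in>{..r}. ?t (Suc k)) \<oplus> ?t 0)"
      using a b by (subst finsum_Suc, force, subst finsum_Suc2) (auto simp: r)
    also have "(\<Oplus>k\<in>{..r}. ?t (Suc k)) = (\<Oplus>k\<in>{..r}. \<zero>)"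
      using mid by (intro finsum_cong') auto
    finally show ?thesis using a b by simp
  qed
  show ?thesis
  proof (induction k)
    case 0
    then show ?case using x y by simp
  next
    case (Suc k)
    have "(x \<oplus> y) [^] (p ^ Suc k) = ((x \<oplus> y) [^] (p ^ k)) [^] p"
      using x y by (simp add: nat_pow_pow mult.commute)
    also have "\<dots> = (x [^] (p ^ k)) [^] p \<oplus> (y [^] (p ^ k)) [^] p"
      using x y by (simp add: Suc.IH step)
    finally show ?case using x y by (simp add: nat_pow_pow mult.commute)
  qed
qed

text \<open>Additivity applied to \<open>(x \<ominus> y) \<oplus> y\<close>. This avoids the sign of
  a power of \<open>-1\<close> and a separate case \<open>p = 2\<close>.\<close>

lemma (in cring) frobenius_minus:
  fixes p k :: nat
  assumes p: "prime p" and char: "[p] \<cdot> \<one> = \<zero>"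
    and x: "x \<in> carrier R" and y: "y \<in> carrier R"
  shows "(x \<ominus> y) [^] (p ^ k) = x [^] (p ^ k) \<ominus> y [^] (p ^ k)"
proof -
  have "(x \<ominus> y) [^] (p ^ k) \<oplus> y [^] (p ^ k) = (x \<ominus> y \<oplus> y) [^] (p ^ k)"
    using x y by (simp add: frobenius_add[OF p char])
  also have "x \<ominus> y \<oplus> y = x" using x y by algebra
  finally have "x [^] (p ^ k) = (x \<ominus> y) [^] (p ^ k) \<oplus> y [^] (p ^ k)" ..
  then show ?thesis
    using x y by (simp add: a_minus_def a_assoc r_neg)
qed

section \<open>Fixed fields of Frobenius powers\<close>

text \<open>
  Over a root \<open>a\<close> the polynomial becomes \<open>(X - a)^N - (X - a)\<close>, so all roots are simple.
\<close>

lemma (in algebraically_closed) card_frobenius_fixed: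
  fixes p k :: nat
  assumes p: "prime p" and char: "[p] \<cdot> \<one> = \<zero>" and k: "k > 0"
  shows "finite {x \<in> carrier L. x [^] (p ^ k) = x}" (is "finite ?F")
    and "card {x \<in> carrier L. x [^] (p ^ k) = x} = p ^ k"
proof -
  let ?P = "poly_ring L"
  interpret UP: domain ?P
    using univ_poly_is_domain[OF carrier_is_subring] .
  define N where "N = p ^ k"
  have N: "N \<ge> 2"
    using prime_ge_2_nat[OF p] k unfolding N_def
    by (metis One_nat_def Suc_1 Suc_le_eq less_le_trans one_less_power prime_gt_1_nat p)
  have X: "X \<in> carrier ?P" by (rule var_closed(1)[OF carrier_is_subring])
  define f where "f = X [^]\<^bsub>?P\<^esub> N \<ominus>\<^bsub>?P\<^esub> X"
  have f: "f \<in> carrier ?P" unfolding f_def using X by simp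
  have degX: "Polynomials.degree X = 1" by (simp add: var_def)
  have degf: "Polynomials.degree f = N"
  proof -
    have "Polynomials.degree (X [^]\<^bsub>?P\<^esub> N) = N" using polynomial_pow_degree[OF X] degX by simp
    moreover have "Polynomials.degree (\<ominus>\<^bsub>?P\<^esub> X) = 1"
      using univ_poly_a_inv_degree[OF carrier_is_subring X] degX by simp
    moreover have "Polynomials.degree (X [^]\<^bsub>?P\<^esub> N \<oplus>\<^bsub>?P\<^esub> (\<ominus>\<^bsub>?P\<^esub> X)) =
        max (Polynomials.degree (X [^]\<^bsub>?P\<^esub> N)) (Polynomials.degree (\<ominus>\<^bsub>?P\<^esub> X))"
      using calculation N X unfolding univ_poly_add
      by (intro poly_add_degree_eq[OF carrier_is_subring]) (auto simp: univ_poly_carrier)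
    ultimately show ?thesis using N unfolding f_def a_minus_def by simp
  qed
  have f0: "f \<noteq> []" using degf N by auto
  have root_iff: "is_root f a \<longleftrightarrow> a \<in> carrier L \<and> a [^] N = a" for a
  proof (cases "a \<in> carrier L")
    case a: True
    interpret ev: ring_hom_ring ?P L "\<lambda>g. eval g a"
      using eval_ring_hom[OF carrier_is_subring a] .
    have "eval f a = a [^] N \<ominus> a"
      unfolding f_def a_minus_def using X a by (simp add: eval_var ev.hom_nat_pow)
    then show ?thesis using a f0 by (simp add: is_root_def)
  qed (simp add: is_root_def)
  have simple: "alg_mult f a \<le> 1" if a: "a \<in> carrier L" and aN: "a [^] N = a" for a
  proof (rule ccontr)
    assume "\<not> alg_mult f a \<le> 1"
    then have le: "2 \<le> alg_mult f a" by simp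
    \<comment> \<open>\<open>Y\<close> is the linear factor \<open>X - a\<close>, whose square would
      divide \<open>f\<close> if \<open>a\<close> were a multiple root.\<close>
    define Y where "Y = [\<one>, \<ominus> a]"
    interpret h: ring_hom_ring L ?P poly_of_const
      using canonical_embedding_ring_hom[OF carrier_is_subring] by simp
    interpret ev: ring_hom_ring ?P L "\<lambda>g. eval g a"
      using eval_ring_hom[OF carrier_is_subring a] .
    define d where "d = poly_of_const (\<ominus> a)"
    have d: "d \<in> carrier ?P" unfolding d_def using a by simp
    have Y: "Y = X \<oplus>\<^bsub>?P\<^esub> d"
      using a by (auto simp: Y_def d_def var_def univ_poly_add poly_of_const_def)
    have Yc: "Y \<in> carrier ?P" using Y X d by simp
    \<comment> \<open>So \<open>\<ominus> a\<close> is fixed as well. Hence \<open>d\<close> equals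
      its own \<open>N\<close>-th power, and \<open>f\<close> keeps its form when \<open>Y\<close>
      replaces \<open>X\<close>.\<close>
    have "(\<zero> \<ominus> a) [^] N = \<zero> [^] N \<ominus> a [^] N"
      unfolding N_def using a by (intro frobenius_minus[OF p char]) auto
    then have "(\<ominus> a) [^] N = \<ominus> a" using a aN N by (simp add: a_minus_def nat_pow_zero)
    then have dN: "d [^]\<^bsub>?P\<^esub> N = d" using a by (metis d_def h.hom_nat_pow a_inv_closed)
    have "[n] \<cdot>\<^bsub>?P\<^esub> \<one>\<^bsub>?P\<^esub> = poly_of_const ([n] \<cdot> \<one>)" for n :: nat
      by (induction n) (simp_all add: add.nat_pow_Suc UP.add.nat_pow_Suc)
    then have charP: "[p] \<cdot>\<^bsub>?P\<^esub> \<one>\<^bsub>?P\<^esub> = \<zero>\<^bsub>?P\<^esub>" using char by simp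
    have "Y [^]\<^bsub>?P\<^esub> N = X [^]\<^bsub>?P\<^esub> N \<oplus>\<^bsub>?P\<^esub> d"
      using UP.frobenius_add[OF p charP X d, of k] dN by (simp add: Y N_def)
    then have fY: "f = Y [^]\<^bsub>?P\<^esub> N \<ominus>\<^bsub>?P\<^esub> Y"
      unfolding f_def Y using X d
      by (simp add: a_minus_def UP.minus_add UP.a_assoc UP.a_lcomm[of d] UP.r_neg)
    obtain M where M: "N = Suc (Suc M)" using that[of "N - 2"] N by simp
    have "(Y [^]\<^bsub>?P\<^esub> (2::nat)) pdivides f"
      using le_alg_mult_imp_pdivides[OF a f le] unfolding Y_def .
    then obtain g where g: "g \<in> carrier ?P" "f = Y [^]\<^bsub>?P\<^esub> (2::nat) \<otimes>\<^bsub>?P\<^esub> g"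
      unfolding pdivides_def factor_def by auto
    \<comment> \<open>From \<open>f = Y^(M+2) - Y = Y^2 g\<close> follows
      \<open>Y = Y^2 (Y^M - g)\<close>. Cancelling one \<open>Y\<close> makes \<open>Y\<close> a
      unit with inverse \<open>e\<close>, which fails when evaluated at its root
      \<open>a\<close>.\<close>
    define e where "e = Y [^]\<^bsub>?P\<^esub> M \<ominus>\<^bsub>?P\<^esub> g"
    have e: "e \<in> carrier ?P" unfolding e_def using Yc g by simp
    have "Y [^]\<^bsub>?P\<^esub> M \<otimes>\<^bsub>?P\<^esub> Y \<otimes>\<^bsub>?P\<^esub> Y \<ominus>\<^bsub>?P\<^esub> Y = \<one>\<^bsub>?P\<^esub> \<otimes>\<^bsub>?P\<^esub> Y \<otimes>\<^bsub>?P\<^esub> Y \<otimes>\<^bsub>?P\<^esub> g"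
      using fY g(2) Yc by (simp add: M numeral_2_eq_2)
    moreover have "Y = W \<otimes>\<^bsub>?P\<^esub> Y \<otimes>\<^bsub>?P\<^esub> Y \<ominus>\<^bsub>?P\<^esub> (W \<otimes>\<^bsub>?P\<^esub> Y \<otimes>\<^bsub>?P\<^esub> Y \<ominus>\<^bsub>?P\<^esub> Y)"
      if "W \<in> carrier ?P" for W
      using that Yc by algebra
    ultimately have "Y = Y [^]\<^bsub>?P\<^esub> M \<otimes>\<^bsub>?P\<^esub> Y \<otimes>\<^bsub>?P\<^esub> Y \<ominus>\<^bsub>?P\<^esub> \<one>\<^bsub>?P\<^esub> \<otimes>\<^bsub>?P\<^esub> Y \<otimes>\<^bsub>?P\<^esub> Y \<otimes>\<^bsub>?P\<^esub> g"
      using UP.nat_pow_closed[OF Yc, of M] by metis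
    also have "\<dots> = Y \<otimes>\<^bsub>?P\<^esub> (Y \<otimes>\<^bsub>?P\<^esub> e)"
      unfolding e_def using Yc g(1) UP.nat_pow_closed[OF Yc, of M] by algebra
    finally have "Y \<otimes>\<^bsub>?P\<^esub> \<one>\<^bsub>?P\<^esub> = Y \<otimes>\<^bsub>?P\<^esub> (Y \<otimes>\<^bsub>?P\<^esub> e)"
      using Yc by simp
    moreover have "Y \<noteq> \<zero>\<^bsub>?P\<^esub>" by (simp add: Y_def univ_poly_zero)
    ultimately have "\<one>\<^bsub>?P\<^esub> = Y \<otimes>\<^bsub>?P\<^esub> e"
      using UP.m_lcancel[of Y "\<one>\<^bsub>?P\<^esub>" "Y \<otimes>\<^bsub>?P\<^esub> e"] Yc e by blast
    then have "\<one> = eval Y a \<otimes> eval e a"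
      using Yc e by (metis ev.hom_one ev.hom_mult)
    moreover have "eval Y a = \<zero>" using a by (simp add: Y_def r_neg)
    ultimately show False using e by simp
  qed
  have set: "set_mset (roots f) = ?F"
    using roots_mem_iff_is_root[OF f] root_iff unfolding N_def by auto
  then show "finite ?F" by (metis finite_set_mset)
  \<comment> \<open>As all roots are simple, counting them with or without multiplicity agrees; with
    multiplicity there are \<open>N\<close>, since \<open>f\<close> splits.\<close>
  have "count (roots f) a = 1" if "a \<in> ?F" for a
  proof -
    have "count (roots f) a > 0" using that set by simp
    moreover have "count (roots f) a \<le> 1"
      using simple[of a] that alg_mult_eq_count_roots[OF f] by (simp add: N_def)
    ultimately show ?thesis by linarith
  qed
  then have "size (roots f) = card ?F"
    unfolding size_multiset_overloaded_eq set by simp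
  then show "card ?F = p ^ k"
    using roots_over_carrier[OF f] degf by (simp add: splitted_def N_def)
qed


lemma (in algebraically_closed) frobenius_fixed_subfield:
  fixes p k :: nat
  assumes p: "prime p" and char: "[p] \<cdot> \<one> = \<zero>"
  shows "subfield {x \<in> carrier L. x [^] (p ^ k) = x} L" (is "subfield ?F L")
proof -
  have pos: "p ^ k > 0" using prime_gt_0_nat[OF p] by simp
  show ?thesis
  proof (rule subfieldI')
    show "subring ?F L"
    proof (rule ring.subringI[OF ring_axioms])
      fix x assume x: "x \<in> ?F"
      have "(\<zero> \<ominus> x) [^] (p ^ k) = \<zero> [^] (p ^ k) \<ominus> x [^] (p ^ k)"
        using x by (intro frobenius_minus[OF p char]) auto
      then show "\<ominus> x \<in> ?F" using x pos by (simp add: a_minus_def nat_pow_zero)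
    qed (auto simp: nat_pow_distrib frobenius_add[OF p char])
    fix x assume x: "x \<in> ?F - {\<zero>}"
    then have u: "x \<in> Units L" by (simp add: field_Units)
    \<comment> \<open>Since \<open>x\<close> equals its own power, the power of \<open>inv x\<close>
      is again an inverse of \<open>x\<close>; inverses are unique.\<close>
    have "x \<otimes> (inv x) [^] (p ^ k) = (x \<otimes> inv x) [^] (p ^ k)"
      using x u by (subst nat_pow_distrib) auto
    then have "inv x = (inv x) [^] (p ^ k)"
      using x u by (intro comm_inv_char) auto
    then show "inv x \<in> ?F" using u by simp
  qed
qed

text \<open>Both fields are cut out of one algebraic closure of the integers modulo \<open>p\<close>
  as fixed sets of Frobenius powers, which yields the inclusion without constructing an
  embedding.\<close>

lemma finite_field_tower:
  fixes q :: nat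
  assumes "primepow q"
  obtains L :: "((int list \<times> nat) multiset \<Rightarrow> int) ring" and F K
  where "field L" "subfield F L" "subfield K L" "K \<subseteq> F"
    "finite F" "card F = q ^ 3" "card K = q"
proof -
  obtain p k where p: "prime p" and k: "k > 0" and q: "q = p ^ k"
    using assms by (auto simp: primepow_def)
  define R where "R = residue_ring (int p)"
  interpret res: residues_prime p R
    using p by unfold_locales (simp_all add: R_def)
  define L where "L = field.alg_closure R"
  interpret L: algebraic_closure L "res.indexed_const ` carrier R"
    unfolding L_def by (rule res.alg_closureE)
  have hom: "res.indexed_const \<in> ring_hom R L"
    unfolding L_def by (rule res.alg_closureE)
  interpret hom: ring_hom_ring R L res.indexed_const
    by (rule ring_hom_ringI2[OF res.ring_axioms L.ring_axioms hom])
  have "[n] \<cdot>\<^bsub>R\<^esub> \<one>\<^bsub>R\<^esub> = int n mod int p" for n :: nat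
    by (induction n) (auto simp: res.add.nat_pow_Suc res.res_add_eq res.res_one_eq res.res_zero_eq mod_simps add.commute)
  then have "[p] \<cdot>\<^bsub>R\<^esub> \<one>\<^bsub>R\<^esub> = \<zero>\<^bsub>R\<^esub>" by (simp add: res.res_zero_eq)
  moreover have "[n] \<cdot>\<^bsub>L\<^esub> \<one>\<^bsub>L\<^esub> = res.indexed_const ([n] \<cdot>\<^bsub>R\<^esub> \<one>\<^bsub>R\<^esub>)" for n :: nat
    by (induction n) (simp_all add: L.add.nat_pow_Suc res.add.nat_pow_Suc)
  ultimately have char: "[p] \<cdot>\<^bsub>L\<^esub> \<one>\<^bsub>L\<^esub> = \<zero>\<^bsub>L\<^esub>" by simp
  let ?fix = "\<lambda>k. {x \<in> carrier L. x [^]\<^bsub>L\<^esub> (p ^ k) = x}"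
  have q3: "p ^ (3 * k) = q * q * q"
    by (simp add: q numeral_3_eq_3 power_add)
  show thesis
  proof (rule that)
    show "field L" by (rule L.field_axioms)
    show "subfield (?fix (3 * k)) L" "subfield (?fix k) L"
      by (rule L.frobenius_fixed_subfield[OF p char])+
    \<comment> \<open>The exponent is written as \<open>q * q * q\<close> so that raising to the
      power \<open>q\<close> is applied three times.\<close>
    show "?fix k \<subseteq> ?fix (3 * k)"
      unfolding q3 by (auto simp: q simp flip: L.nat_pow_pow)
    show "finite (?fix (3 * k))"
      using k by (intro L.card_frobenius_fixed[OF p char]) simp
    show "card (?fix (3 * k)) = q ^ 3"
      using k L.card_frobenius_fixed(2)[OF p char, of "3 * k"] q3
      by (simp add: power3_eq_cube)
    show "card (?fix k) = q"
      using L.card_frobenius_fixed(2)[OF p char k] by (simp add: q)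
  qed
qed

section \<open>The projective plane over a finite field\<close>

locale field_tower = field R for R (structure) +
  fixes F K :: "'a set" and q :: nat
  assumes subfield_F: "subfield F R" and subfield_K: "subfield K R"
    and K_sub: "K \<subseteq> F" and finite_F: "finite F"
    and card_F: "card F = q ^ 3" and card_K: "card K = q" and q_gt_1: "q > 1"
begin

text \<open>\<open>F\<close> serves as a three-dimensional space over \<open>K\<close>, and a point
  is a one-dimensional subspace without zero. Lines are the multiples of one fixed two-dimensional
  subspace, so multiplication by a nonzero element of \<open>F\<close> permutes both points and
  lines.\<close>

definition point :: "'a \<Rightarrow> 'a set" where
  "point x = (\<lambda>k. k \<otimes> x) ` (K - {\<zero>})"

definition points :: "'a set set" where
  "points = point ` (F - {\<zero>})"

text \<open>Any element outside \<open>K\<close> is linearly independent of \<open>\<one>\<close>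
  over \<open>K\<close>; the two span \<open>plane\<close>.\<close>

definition gen :: 'a where
  "gen = (SOME a. a \<in> F - K)"

definition plane :: "'a set" where
  "plane = (\<lambda>(k, l). k \<oplus> l \<otimes> gen) ` (K \<times> K)"

definition line :: "'a \<Rightarrow> 'a set set" where
  "line g = point ` (\<lambda>v. g \<otimes> v) ` (plane - {\<zero>})"

lemma F_carrier: "x \<in> F \<Longrightarrow> x \<in> carrier R"
  using subfieldE(3)[OF subfield_F] by blast

lemma K_F: "x \<in> K \<Longrightarrow> x \<in> F"
  using K_sub by blast

lemmas carrier_simps = F_carrier K_F

lemma F_closed:
  "\<zero> \<in> F" "\<one> \<in> F" "x \<in> F \<Longrightarrow> \<ominus> x \<in> F"
  "x \<in> F \<Longrightarrow> y \<in> F \<Longrightarrow> x \<oplus> y \<in> F" "x \<in> F \<Longrightarrow> y \<in> F \<Longrightarrow> x \<otimes> y \<in> F"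
  using subringE[OF subfieldE(1)[OF subfield_F]] by auto

lemma K_closed:
  "\<zero> \<in> K" "\<one> \<in> K" "x \<in> K \<Longrightarrow> \<ominus> x \<in> K"
  "x \<in> K \<Longrightarrow> y \<in> K \<Longrightarrow> x \<oplus> y \<in> K" "x \<in> K \<Longrightarrow> y \<in> K \<Longrightarrow> x \<otimes> y \<in> K"
  using subringE[OF subfieldE(1)[OF subfield_K]] by auto

lemma F_inv: "x \<in> F \<Longrightarrow> x \<noteq> \<zero> \<Longrightarrow> inv x \<in> F \<and> inv x \<noteq> \<zero> \<and> inv x \<otimes> x = \<one> \<and> x \<otimes> inv x = \<one>"
  using subfield_m_inv[OF subfield_F, of x] by auto

lemma K_inv: "x \<in> K \<Longrightarrow> x \<noteq> \<zero> \<Longrightarrow> inv x \<in> K \<and> inv x \<noteq> \<zero> \<and> inv x \<otimes> x = \<one> \<and> x \<otimes> inv x = \<one>"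
  using subfield_m_inv[OF subfield_K, of x] by auto

lemma finite_K: "finite K"
  using K_sub finite_F by (rule finite_subset)

lemma mult_eq_0_iff: "x \<in> F \<Longrightarrow> y \<in> F \<Longrightarrow> x \<otimes> y = \<zero> \<longleftrightarrow> x = \<zero> \<or> y = \<zero>"
  using integral_iff F_carrier by auto

lemma mult_left_cancel_F:
  "g \<in> F \<Longrightarrow> g \<noteq> \<zero> \<Longrightarrow> x \<in> F \<Longrightarrow> y \<in> F \<Longrightarrow> g \<otimes> x = g \<otimes> y \<longleftrightarrow> x = y"
  using m_lcancel F_carrier by auto

lemma mult_right_cancel_F:
  "g \<in> F \<Longrightarrow> g \<noteq> \<zero> \<Longrightarrow> x \<in> F \<Longrightarrow> y \<in> F \<Longrightarrow> x \<otimes> g = y \<otimes> g \<longleftrightarrow> x = y"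
  using m_rcancel F_carrier by auto

lemma gen: "gen \<in> F" "gen \<notin> K"
proof -
  have "card K < card F"
    using q_gt_1 using power_strict_increasing[of 1 3 q] by (simp add: card_F card_K)
  then have "\<not> F \<subseteq> K" using finite_K card_mono by (metis leD)
  then have "\<exists>a. a \<in> F - K" by blast
  then have "gen \<in> F - K" unfolding gen_def by (rule someI_ex)
  then show "gen \<in> F" "gen \<notin> K" by auto
qed

lemma plane_F: "plane \<subseteq> F"
  by (auto simp: plane_def F_closed K_F gen)

text \<open>Coordinates are unique: two representations with different \<open>l\<close> would
  express \<open>gen\<close> as a quotient of elements of \<open>K\<close>.\<close>

lemma card_plane: "card plane = q ^ 2"
proof -
  have "inj_on (\<lambda>(k, l). k \<oplus> l \<otimes> gen) (K \<times> K)"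
  proof (rule inj_onI, clarify)
    fix k l k' l' assume k: "k \<in> K" "l \<in> K" "k' \<in> K" "l' \<in> K"
      and eq: "k \<oplus> l \<otimes> gen = k' \<oplus> l' \<otimes> gen"
    note cc [simp] = F_carrier[OF K_F[OF k(1)]] F_carrier[OF K_F[OF k(2)]]
      F_carrier[OF K_F[OF k(3)]] F_carrier[OF K_F[OF k(4)]] F_carrier[OF gen(1)]
    have e: "(l \<ominus> l') \<otimes> gen = k' \<ominus> k"
    proof -
      have "(l \<ominus> l') \<otimes> gen = (k \<oplus> l \<otimes> gen) \<ominus> k \<ominus> l' \<otimes> gen" using cc by algebra
      also have "\<dots> = k' \<ominus> k" unfolding eq using cc by algebra
      finally show ?thesis .
    qed
    have "l = l'"
    proof (rule ccontr)
      assume "l \<noteq> l'"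
      then have nz: "l \<ominus> l' \<noteq> \<zero>" by simp
      have "l \<ominus> l' \<in> K" "k' \<ominus> k \<in> K" using k K_closed by (simp_all add: a_minus_def)
      note i = K_inv[OF this(1) nz] and this
      then have "inv (l \<ominus> l') \<otimes> (k' \<ominus> k) \<in> K" using K_closed by blast
      moreover have "inv (l \<ominus> l') \<otimes> (k' \<ominus> k) = (inv (l \<ominus> l') \<otimes> (l \<ominus> l')) \<otimes> gen"
        using i unfolding e[symmetric] by (subst m_assoc) (auto simp: carrier_simps)
      ultimately show False using i gen by simp
    qed
    with eq show "k = k' \<and> l = l'" by simp
  qed
  then show ?thesis
    unfolding plane_def by (simp add: card_image card_cartesian_product card_K power2_eq_square)
qed

lemma plane_minus: "v \<in> plane \<Longrightarrow> w \<in> plane \<Longrightarrow> v \<ominus> w \<in> plane"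
proof -
  assume "v \<in> plane" "w \<in> plane"
  then obtain k l k' l' where k: "k \<in> K" "l \<in> K" "k' \<in> K" "l' \<in> K"
    and eq: "v = k \<oplus> l \<otimes> gen" "w = k' \<oplus> l' \<otimes> gen"
    by (auto simp: plane_def)
  note cc [simp] = F_carrier[OF K_F[OF k(1)]] F_carrier[OF K_F[OF k(2)]]
      F_carrier[OF K_F[OF k(3)]] F_carrier[OF K_F[OF k(4)]] F_carrier[OF gen(1)]
  have "v \<ominus> w = (k \<ominus> k') \<oplus> (l \<ominus> l') \<otimes> gen" unfolding eq using cc by algebra
  moreover have "k \<ominus> k' \<in> K" "l \<ominus> l' \<in> K" using k K_closed by (simp_all add: a_minus_def)
  ultimately show ?thesis unfolding plane_def by auto
qed

lemma zero_plane: "\<zero> \<in> plane"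
  using K_closed(1) gen F_carrier unfolding plane_def
  by (intro image_eqI[of _ _ "(\<zero>, \<zero>)"]) auto

lemma plane_smult: "c \<in> K \<Longrightarrow> v \<in> plane \<Longrightarrow> c \<otimes> v \<in> plane"
proof -
  assume c: "c \<in> K" and "v \<in> plane"
  then obtain k l where k: "k \<in> K" "l \<in> K" and eq: "v = k \<oplus> l \<otimes> gen"
    by (auto simp: plane_def)
  note cc [simp] = F_carrier[OF K_F[OF k(1)]] F_carrier[OF K_F[OF k(2)]]
      F_carrier[OF K_F[OF c]] F_carrier[OF gen(1)]
  have "c \<otimes> v = c \<otimes> k \<oplus> (c \<otimes> l) \<otimes> gen" unfolding eq using cc by algebra
  then show ?thesis using c k K_closed unfolding plane_def by auto
qed

lemma point_self: "x \<in> F \<Longrightarrow> x \<in> point x"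
  unfolding point_def using K_closed(2) F_carrier by (intro image_eqI[of _ _ \<one>]) auto

lemma card_point: "x \<in> F - {\<zero>} \<Longrightarrow> card (point x) = q - 1"
  unfolding point_def
  by (subst card_image) (auto simp: inj_on_def mult_right_cancel_F K_F K_closed card_K finite_K)

lemma point_smult: "k \<in> K - {\<zero>} \<Longrightarrow> x \<in> F \<Longrightarrow> point (k \<otimes> x) = point x"
proof -
  assume k: "k \<in> K - {\<zero>}" and x: "x \<in> F"
  show ?thesis
  proof (intro equalityI subsetI)
    fix y assume "y \<in> point (k \<otimes> x)"
    then obtain j where j: "j \<in> K - {\<zero>}" and y: "y = j \<otimes> (k \<otimes> x)" by (auto simp: point_def)
    have "y = (j \<otimes> k) \<otimes> x" using j k x y by (simp add: m_assoc carrier_simps)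
    then show "y \<in> point x"
      using j k by (auto simp: point_def K_closed K_F mult_eq_0_iff intro!: image_eqI[of _ _ "j \<otimes> k"])
  next
    fix y assume "y \<in> point x"
    then obtain j where j: "j \<in> K - {\<zero>}" and y: "y = j \<otimes> x" by (auto simp: point_def)
    have i: "inv k \<in> K" "inv k \<noteq> \<zero>" "inv k \<otimes> k = \<one>" using K_inv k by auto
    have "(j \<otimes> inv k) \<otimes> (k \<otimes> x) = j \<otimes> (inv k \<otimes> k) \<otimes> x"
      using j k i(1) x by (simp add: m_assoc carrier_simps)
    then have "y = (j \<otimes> inv k) \<otimes> (k \<otimes> x)" using y j by (simp add: i carrier_simps)
    then show "y \<in> point (k \<otimes> x)"
      using j i by (auto simp: point_def K_closed K_F mult_eq_0_iff intro!: image_eqI[of _ _ "j \<otimes> inv k"])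
  qed
qed

lemma point_disjoint: "x \<in> F \<Longrightarrow> y \<in> F \<Longrightarrow> point x \<noteq> point y \<Longrightarrow> point x \<inter> point y = {}"
proof (rule ccontr)
  assume x: "x \<in> F" and y: "y \<in> F" and ne: "point x \<noteq> point y" and "point x \<inter> point y \<noteq> {}"
  then obtain j k where "j \<in> K - {\<zero>}" "k \<in> K - {\<zero>}" "j \<otimes> x = k \<otimes> y"
    by (auto simp: point_def)
  then show False using ne point_smult x y by metis
qed

text \<open>A set closed under scaling is a disjoint union of points, each with \<open>q - 1\<close>
  elements. This counts both all points and those on a line.\<close>

lemma card_point_image:
  assumes U: "U \<subseteq> F - {\<zero>}" and closed: "\<And>k u. k \<in> K - {\<zero>} \<Longrightarrow> u \<in> U \<Longrightarrow> k \<otimes> u \<in> U"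
  shows "(q - 1) * card (point ` U) = card U"
proof -
  have fin: "finite U" using U finite_F by (meson finite_Diff finite_subset)
  have Un: "\<Union> (point ` U) = U"
  proof (intro equalityI subsetI)
    fix x assume "x \<in> \<Union> (point ` U)"
    then show "x \<in> U" using closed by (auto simp: point_def)
  next
    fix x assume "x \<in> U"
    then show "x \<in> \<Union> (point ` U)" using U point_self by blast
  qed
  have "(q - 1) * card (point ` U) = card (\<Union> (point ` U))"
  proof (rule card_partition)
    show "finite (point ` U)" "finite (\<Union> (point ` U))" using fin Un by auto
    show "card c = q - 1" if "c \<in> point ` U" for c using that U card_point by auto
    show "c1 \<inter> c2 = {}" if "c1 \<in> point ` U" "c2 \<in> point ` U" "c1 \<noteq> c2" for c1 c2
      using that U point_disjoint by blast
  qed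
  then show ?thesis by (simp only: Un)
qed

lemma card_points: "card points = q ^ 2 + q + 1"
proof -
  have "(q - 1) * card points = card (F - {\<zero>})"
    unfolding points_def
    by (intro card_point_image) (auto simp: F_closed K_F mult_eq_0_iff)
  also have "\<dots> = q ^ 3 - 1" using F_closed(1) finite_F card_F by simp
  also have "\<dots> = (q - 1) * (q ^ 2 + q + 1)"
    using q_gt_1 by (cases q) (auto simp: power2_eq_square power3_eq_cube algebra_simps)
  finally show ?thesis using q_gt_1 by (subst (asm) mult_cancel1) simp
qed

lemma finite_points: "finite points"
  unfolding points_def using finite_F by simp

lemma line_points: "g \<in> F - {\<zero>} \<Longrightarrow> line g \<subseteq> points"
  unfolding line_def points_def using plane_F by (auto simp: F_closed mult_eq_0_iff subset_iff)

lemma card_line: assumes g: "g \<in> F - {\<zero>}" shows "card (line g) = q + 1"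
proof -
  let ?U = "(\<lambda>v. g \<otimes> v) ` (plane - {\<zero>})"
  have "(q - 1) * card (line g) = card ?U"
    unfolding line_def
  proof (rule card_point_image)
    show "?U \<subseteq> F - {\<zero>}" using g plane_F by (auto simp: F_closed mult_eq_0_iff subset_iff)
    fix k u assume k: "k \<in> K - {\<zero>}" and "u \<in> ?U"
    then obtain v where v: "v \<in> plane - {\<zero>}" "u = g \<otimes> v" by auto
    then have "v \<in> F" using plane_F by blast
    then have "k \<otimes> u = g \<otimes> (k \<otimes> v)" "k \<otimes> v \<noteq> \<zero>"
      using g k v by (simp_all add: m_lcomm carrier_simps mult_eq_0_iff)
    then show "k \<otimes> u \<in> ?U" using plane_smult k v by auto
  qed
  also have "card ?U = card (plane - {\<zero>})"
    using g plane_F by (intro card_image inj_onI) (auto simp: mult_left_cancel_F subset_iff)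
  also have "\<dots> = q ^ 2 - 1" using zero_plane card_plane by simp
  also have "\<dots> = (q - 1) * (q + 1)"
    using q_gt_1 by (cases q) (auto simp: power2_eq_square algebra_simps)
  finally show ?thesis using q_gt_1 by (subst (asm) mult_cancel1) simp
qed

text \<open>Pigeonhole: \<open>(v, w) \<mapsto> g v + h w\<close> cannot be injective on the \<open>q^4\<close> pairs.\<close>

lemma lines_meet:
  assumes g: "g \<in> F - {\<zero>}" and h: "h \<in> F - {\<zero>}"
  shows "line g \<inter> line h \<noteq> {}"
proof -
  let ?f = "\<lambda>(v, w). g \<otimes> v \<oplus> h \<otimes> w"
  have "?f ` (plane \<times> plane) \<subseteq> F" using g h plane_F by (auto simp: F_closed subset_iff)
  then have "card (?f ` (plane \<times> plane)) \<le> q ^ 3" using card_mono finite_F card_F by metis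
  also have "\<dots> < q ^ 4" using q_gt_1 by (simp add: power_strict_increasing)
  also have "\<dots> = card (plane \<times> plane)" by (simp add: card_cartesian_product card_plane)
  finally have "\<not> inj_on ?f (plane \<times> plane)" using card_image by force
  then obtain v w v' w' where v: "v \<in> plane" "w \<in> plane" "v' \<in> plane" "w' \<in> plane"
    and eq: "g \<otimes> v \<oplus> h \<otimes> w = g \<otimes> v' \<oplus> h \<otimes> w'" and ne: "(v, w) \<noteq> (v', w')"
    by (auto simp: inj_on_def)
  have F: "v \<in> F" "w \<in> F" "v' \<in> F" "w' \<in> F" using v plane_F by auto
  note cc [simp] = F_carrier[OF F(1)] F_carrier[OF F(2)] F_carrier[OF F(3)] F_carrier[OF F(4)]
  have gh [simp]: "g \<in> carrier R" "h \<in> carrier R" using g h F_carrier by auto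
  \<comment> \<open>The collision, rearranged, is a vector common to the two multiples of
    \<open>plane\<close>; it remains to see that it is nonzero.\<close>
  have z: "g \<otimes> (v \<ominus> v') = h \<otimes> (w' \<ominus> w)"
  proof -
    have "g \<otimes> (v \<ominus> v') = (g \<otimes> v \<oplus> h \<otimes> w) \<ominus> h \<otimes> w \<ominus> g \<otimes> v'" using cc gh by algebra
    also have "\<dots> = h \<otimes> (w' \<ominus> w)" unfolding eq using cc gh by algebra
    finally show ?thesis .
  qed
  \<comment> \<open>By \<open>z\<close>, if one difference vanishes so does the other, and then the
    colliding pairs are equal.\<close>
  have "v \<ominus> v' \<noteq> \<zero> \<and> w' \<ominus> w \<noteq> \<zero>"
  proof (rule ccontr)
    assume "\<not> ?thesis"
    then have "v \<ominus> v' = \<zero> \<or> w' \<ominus> w = \<zero>" by blast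
    then have "v \<ominus> v' = \<zero>" "w' \<ominus> w = \<zero>"
      using z g h integral_iff[of g "v \<ominus> v'"] integral_iff[of h "w' \<ominus> w"] by auto
    then show False using ne by simp
  qed
  then have "point (g \<otimes> (v \<ominus> v')) \<in> line g" "point (h \<otimes> (w' \<ominus> w)) \<in> line h"
    unfolding line_def using v by (auto intro!: imageI plane_minus)
  then show ?thesis using z by auto
qed

lemma mult_point: "g \<in> F \<Longrightarrow> x \<in> F \<Longrightarrow> (\<lambda>y. g \<otimes> y) ` point x = point (g \<otimes> x)"
  unfolding point_def image_image
  by (intro image_cong) (auto simp: carrier_simps m_lcomm)

lemma mult_line:
  assumes g: "g \<in> F - {\<zero>}" and h: "h \<in> F - {\<zero>}"
  shows "(`) (\<lambda>y. h \<otimes> y) ` line g = line (h \<otimes> g)"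
  unfolding line_def image_image using g h plane_F
  by (intro image_cong) (auto simp: mult_point F_closed F_carrier m_assoc subset_iff)

lemma mult_bij_betw_points:
  assumes h: "h \<in> F - {\<zero>}"
  shows "bij_betw ((`) (\<lambda>y. h \<otimes> y)) points points"
proof (rule bij_betwI[where g = "(`) (\<lambda>y. inv h \<otimes> y)"])
  have i: "inv h \<in> F" "inv h \<noteq> \<zero>" "inv h \<otimes> h = \<one>" "h \<otimes> inv h = \<one>" using F_inv h by auto
  show "(`) (\<lambda>y. h \<otimes> y) \<in> points \<rightarrow> points" "(`) (\<lambda>y. inv h \<otimes> y) \<in> points \<rightarrow> points"
    using h i by (auto simp: points_def mult_point F_closed mult_eq_0_iff intro!: imageI)
  have "h \<otimes> (inv h \<otimes> x) = x" "inv h \<otimes> (h \<otimes> x) = x" if "x \<in> F" for x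
    using that h i by (simp_all add: F_carrier flip: m_assoc)
  then show "(\<lambda>y. inv h \<otimes> y) ` (\<lambda>y. h \<otimes> y) ` x = x" "(\<lambda>y. h \<otimes> y) ` (\<lambda>y. inv h \<otimes> y) ` x = x"
    if "x \<in> points" for x
    using that h i unfolding points_def
    by (elim imageE; simp only: mult_point F_closed Diff_iff)+
qed

text \<open>Multiplication by the quotient of two representatives carries one point to the
  other.\<close>

lemma points_transitive:
  assumes "c \<in> points" "d \<in> points"
  obtains h where "h \<in> F - {\<zero>}" "(\<lambda>y. h \<otimes> y) ` c = d"
proof -
  obtain x y where x: "x \<in> F - {\<zero>}" "c = point x" and y: "y \<in> F - {\<zero>}" "d = point y"
    using assms by (auto simp: points_def)
  have i: "inv x \<in> F" "inv x \<noteq> \<zero>" "inv x \<otimes> x = \<one>" using F_inv x by auto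
  show thesis
  proof (rule that)
    show "y \<otimes> inv x \<in> F - {\<zero>}" using i y by (auto simp: F_closed mult_eq_0_iff)
    show "(\<lambda>z. y \<otimes> inv x \<otimes> z) ` c = d"
      using x y i by (simp add: mult_point F_closed m_assoc F_carrier)
  qed
qed

end

text \<open>The points are renumbered by an enumeration \<open>e\<close>. The last property records
  that multiplications act transitively on points while preserving lines.\<close>

lemma projective_plane:
  fixes q m :: nat
  assumes q: "primepow q" and m: "m = q ^ 2 + q + 1"
  obtains \<L> :: "nat set set"
  where "\<L> \<noteq> {}" "\<And>l. l \<in> \<L> \<Longrightarrow> l \<subseteq> {..<m}" "\<And>l. l \<in> \<L> \<Longrightarrow> card l = q + 1"
    "\<And>l l'. l \<in> \<L> \<Longrightarrow> l' \<in> \<L> \<Longrightarrow> l \<inter> l' \<noteq> {}"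
    "\<And>u v. u < m \<Longrightarrow> v < m \<Longrightarrow>
      \<exists>g. bij_betw g {..<m} {..<m} \<and> g u = v \<and> (\<forall>l\<in>\<L>. g ` l \<in> \<L>)"
proof -
  obtain L :: "((int list \<times> nat) multiset \<Rightarrow> int) ring" and F K
    where L: "field L" "subfield F L" "subfield K L" "K \<subseteq> F" "finite F" "card F = q ^ 3" "card K = q"
    using finite_field_tower[OF q] .
  interpret field_tower L F K q
    using L primepow_gt_Suc_0[OF q] by (auto simp: field_tower_def field_tower_axioms_def)
  obtain e where e: "bij_betw e points {..<m}"
    using finite_points card_points m by (metis finite_same_card_bij card_lessThan finite_lessThan)
  define d where "d = inv_into points e"
  have d: "bij_betw d {..<m} points" unfolding d_def by (rule bij_betw_inv_into[OF e])
  have de: "d (e c) = c" if "c \<in> points" for c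
    using that e by (simp add: d_def bij_betw_inv_into_left)
  have ed: "e (d u) = u" if "u < m" for u
    using that e by (simp add: d_def bij_betw_inv_into_right)
  let ?G = "F - {\<zero>\<^bsub>L\<^esub>}"
  show thesis
  proof (rule that[of "(\<lambda>g. e ` line g) ` ?G"])
    show "(\<lambda>g. e ` line g) ` ?G \<noteq> {}" using F_closed(2) by auto
    fix l assume "l \<in> (\<lambda>g. e ` line g) ` ?G"
    then obtain g where g: "g \<in> ?G" and l: "l = e ` line g" by auto
    show "l \<subseteq> {..<m}" using l line_points[OF g] e by (auto simp: bij_betw_def)
    show "card l = q + 1"
      using l card_line[OF g] line_points[OF g] e card_image inj_on_subset
      by (metis bij_betw_def)
    fix l' assume "l' \<in> (\<lambda>g. e ` line g) ` ?G"
    then obtain h where h: "h \<in> ?G" and l': "l' = e ` line h" by auto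
    show "l \<inter> l' \<noteq> {}" using lines_meet[OF g h] by (auto simp: l l')
  next
    fix u v assume u: "u < m" and v: "v < m"
    have "d u \<in> points" "d v \<in> points" using u v d by (auto simp: bij_betw_def)
    then obtain h where h: "h \<in> ?G" and huv: "(\<lambda>y. h \<otimes>\<^bsub>L\<^esub> y) ` d u = d v"
      by (rule points_transitive)
    let ?T = "(`) (\<lambda>y. h \<otimes>\<^bsub>L\<^esub> y)"
    show "\<exists>g. bij_betw g {..<m} {..<m} \<and> g u = v \<and>
      (\<forall>l\<in>(\<lambda>g. e ` line g) ` ?G. g ` l \<in> (\<lambda>g. e ` line g) ` ?G)"
    \<comment> \<open>The witness is multiplication by \<open>h\<close>, conjugated by the
      enumeration.\<close>
    proof (intro exI[of _ "e \<circ> (?T \<circ> d)"] conjI ballI)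
      show "bij_betw (e \<circ> (?T \<circ> d)) {..<m} {..<m}"
        using bij_betw_trans[OF bij_betw_trans[OF d mult_bij_betw_points[OF h]] e] .
      show "(e \<circ> (?T \<circ> d)) u = v" using huv ed[OF v] by simp
      fix l assume "l \<in> (\<lambda>g. e ` line g) ` ?G"
      then obtain g where g: "g \<in> ?G" and l: "l = e ` line g" by auto
      have "(e \<circ> (?T \<circ> d)) ` l = e ` ?T ` line g"
        unfolding l image_image using line_points[OF g] de by (intro image_cong) auto
      also have "\<dots> = e ` line (h \<otimes>\<^bsub>L\<^esub> g)" by (simp add: mult_line[OF g h])
      finally show "(e \<circ> (?T \<circ> d)) ` l \<in> (\<lambda>g. e ` line g) ` ?G"
        using g h by (auto simp: F_closed mult_eq_0_iff)
    qed
  qed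
qed

section \<open>Rules given by a family of winning sets\<close>

definition ones :: "nat \<Rightarrow> (nat \<Rightarrow> int) \<Rightarrow> nat set" where
  "ones n x = {i\<in>{1..n}. x i = 1}"

definition family_rule :: "nat \<Rightarrow> nat set set \<Rightarrow> (nat \<Rightarrow> int) \<Rightarrow> int" where
  "family_rule n W x = (if ones n x \<in> W then 1 else -1)"

text \<open>The restricted lambda makes the point \<open>undefined\<close> off
  \<open>{1..n}\<close>, as membership in \<open>cube n\<close> demands; this gives the inverse of
  \<open>ones n\<close> on the cube.\<close>

definition indicator_point :: "nat \<Rightarrow> nat set \<Rightarrow> nat \<Rightarrow> int" where
  "indicator_point n S = (\<lambda>i\<in>{1..n}. if i \<in> S then 1 else -1)"

lemma indicator_point_cube: "indicator_point n S \<in> cube n"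
  by (auto simp: indicator_point_def cube_def)

lemma ones_indicator_point: "S \<subseteq> {1..n} \<Longrightarrow> ones n (indicator_point n S) = S"
  by (auto simp: indicator_point_def ones_def)

lemma ones_subset: "ones n x \<subseteq> {1..n}"
  by (auto simp: ones_def)

lemma cube_val: "x \<in> cube n \<Longrightarrow> i \<in> {1..n} \<Longrightarrow> x i = 1 \<or> x i = -1"
  by (auto simp: cube_def PiE_def Pi_def)

lemma bij_betw_indicator_point: "bij_betw (indicator_point n) (Pow {1..n}) (cube n)"
proof (rule bij_betwI[where g = "ones n"])
  show "indicator_point n (ones n x) = x" if "x \<in> cube n" for x
  proof
    fix i
    show "indicator_point n (ones n x) i = x i"
      using cube_val[OF that, of i] that by (auto simp: indicator_point_def ones_def cube_def PiE_def extensional_def)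
  qed
qed (auto simp: indicator_point_cube ones_indicator_point, auto simp: ones_def)

lemma pmf_iid_indicator_point:
  assumes "S \<subseteq> {1..n}"
  shows "pmf (iid_measure n p) (indicator_point n S) = pmf p 1 ^ card S * pmf p (-1) ^ (n - card S)"
proof -
  have "pmf (iid_measure n p) (indicator_point n S) = (\<Prod>i\<in>{1..n}. pmf p (indicator_point n S i))"
    unfolding iid_measure_def by (rule pmf_Pi') (auto simp: indicator_point_def)
  also have "\<dots> = (\<Prod>i\<in>{1..n}. if i \<in> S then pmf p 1 else pmf p (-1))"
    by (intro prod.cong) (auto simp: indicator_point_def)
  also have "\<dots> = (\<Prod>i\<in>{1..n} \<inter> S. pmf p 1) * (\<Prod>i\<in>{1..n} \<inter> - S. pmf p (-1))"
    by (subst prod.If_cases) (auto intro!: arg_cong2[where f = "(*)"] prod.cong)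
  also have "{1..n} \<inter> S = S" using assms by auto
  also have "{1..n} \<inter> - S = {1..n} - S" by auto
  finally show ?thesis
    using assms by (simp add: card_Diff_subset finite_subset)
qed

lemma flip_indicator_point:
  assumes "S \<subseteq> {1..n}" "i \<in> {1..n}"
  shows "ones n (flip i (indicator_point n S)) = (if i \<in> S then S - {i} else insert i S)"
  using assms by (auto simp: ones_def flip_def indicator_point_def split: if_splits)

lemma influence_family_rule:
  assumes p: "set_pmf p \<subseteq> {-1, 1}" and i: "i \<in> {1..n}"
  shows "influence (iid_measure n p) i (family_rule n W) =
    (\<Sum>S | S \<subseteq> {1..n} \<and> (S \<in> W) \<noteq> ((if i \<in> S then S - {i} else insert i S) \<in> W).
      pmf p 1 ^ card S * pmf p (-1) ^ (n - card S))"
proof -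
  let ?\<Phi> = "family_rule n W" and ?\<mu> = "iid_measure n p"
  let ?A = "{x. ?\<Phi> x \<noteq> ?\<Phi> (flip i x)}"
  let ?P = "{S. S \<subseteq> {1..n} \<and> (S \<in> W) \<noteq> ((if i \<in> S then S - {i} else insert i S) \<in> W)}"
  have sub: "set_pmf ?\<mu> \<subseteq> cube n"
    unfolding iid_measure_def using set_Pi_pmf_subset'[of "{1..n}" undefined "\<lambda>_. p"] p
    by (fastforce simp: cube_def PiE_dflt_def PiE_def extensional_def)
  have fin: "finite (cube n)" by (auto simp: cube_def intro: finite_PiE)
  \<comment> \<open>The event may contain points off the cube, but these have probability zero;
    after intersecting, it is finite.\<close>
  have "?A \<inter> set_pmf ?\<mu> = (?A \<inter> cube n) \<inter> set_pmf ?\<mu>" using sub by auto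
  then have "influence ?\<mu> i ?\<Phi> = measure_pmf.prob ?\<mu> (?A \<inter> cube n)"
    unfolding influence_def by (metis measure_Int_set_pmf)
  also have "\<dots> = sum (pmf ?\<mu>) (?A \<inter> cube n)"
    using fin by (intro measure_measure_pmf_finite) simp
  also have "?A \<inter> cube n = indicator_point n ` ?P"
  proof -
    have iff: "indicator_point n S \<in> ?A \<longleftrightarrow> S \<in> ?P" if "S \<subseteq> {1..n}" for S
      using that i by (simp add: family_rule_def flip_indicator_point ones_indicator_point)
    show ?thesis
    proof (intro equalityI subsetI)
      fix x assume x: "x \<in> ?A \<inter> cube n"
      then obtain S where S: "S \<subseteq> {1..n}" "x = indicator_point n S"
        using bij_betw_imp_surj_on[OF bij_betw_indicator_point] by blast
      then show "x \<in> indicator_point n ` ?P" using x iff[OF S(1)] by (intro image_eqI) simp_all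
    next
      fix x assume "x \<in> indicator_point n ` ?P"
      then obtain S where S: "S \<in> ?P" "x = indicator_point n S" by (rule imageE)
      then have "S \<subseteq> {1..n}" by simp
      then show "x \<in> ?A \<inter> cube n" using S iff indicator_point_cube by simp
    qed
  qed
  also have "sum (pmf ?\<mu>) (indicator_point n ` ?P) = (\<Sum>S\<in>?P. pmf ?\<mu> (indicator_point n S))"
    by (intro sum.reindex[unfolded comp_def]
        inj_on_subset[OF bij_betw_imp_inj_on[OF bij_betw_indicator_point]]) blast
  also have "\<dots> = (\<Sum>S\<in>?P. pmf p 1 ^ card S * pmf p (-1) ^ (n - card S))"
    by (intro sum.cong refl pmf_iid_indicator_point) simp
  finally show ?thesis .
qed

text \<open>
  For monotone \<open>W\<close> the pivotal pairs \<open>(S, S \<union> {i})\<close> of a given size are counted by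
  the members of \<open>W\<close> through \<open>i\<close> on two consecutive levels.
\<close>

lemma family_rule_unbiased:
  assumes W: "\<And>S. S \<in> W \<Longrightarrow> S \<subseteq> {1..n}"
    and up: "\<And>S T. S \<in> W \<Longrightarrow> S \<subseteq> T \<Longrightarrow> T \<subseteq> {1..n} \<Longrightarrow> T \<in> W"
    and regular: "\<And>i j k. i \<in> {1..n} \<Longrightarrow> j \<in> {1..n} \<Longrightarrow>
      card {S\<in>W. card S = k \<and> i \<in> S} = card {S\<in>W. card S = k \<and> j \<in> S}"
  shows "unbiased n (family_rule n W)"
  unfolding unbiased_def
proof (intro allI impI ballI)
  fix p :: "int pmf" and i j assume p: "set_pmf p \<subseteq> {-1, 1}" and i: "i \<in> {1..n}" and j: "j \<in> {1..n}"
  \<comment> \<open>\<open>w k\<close> is the probability of a single point with \<open>k\<close>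
    ones, and \<open>g k\<close> that of a pivotal pair with \<open>k\<close> and
    \<open>Suc k\<close> ones.\<close>
  define w :: "nat \<Rightarrow> real" where "w k = pmf p 1 ^ k * pmf p (-1) ^ (n - k)" for k
  define g where "g k = w k + w (Suc k)" for k
  have finW: "finite W" using W by (intro finite_subset[of W "Pow {1..n}"]) auto
  define d where "d i h = (\<Sum>S | S \<in> W \<and> i \<in> S. h (card S))" for i and h :: "nat \<Rightarrow> real"
  have d_eq: "d i h = d j h" for h
  proof -
    have "d u h = (\<Sum>k\<le>n. h k * card {S\<in>W. card S = k \<and> u \<in> S})" for u
    proof -
      have "card S \<le> n" if "S \<in> W" for S
        using card_mono[OF _ W[OF that]] by simp
      \<comment> \<open>Grouping by size brings in the level counts, which by \<open>regular\<close>
        do not depend on the voter.\<close>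
      then have "d u h = (\<Sum>k\<le>n. \<Sum>S\<in>{S\<in>{S\<in>W. u \<in> S}. card S = k}. h (card S))"
        unfolding d_def using finW by (intro sum.group[symmetric]) auto
      also have "\<dots> = (\<Sum>k\<le>n. h k * card {S\<in>W. card S = k \<and> u \<in> S})"
        by (intro sum.cong) (auto intro!: arg_cong[where f = card])
      finally show ?thesis .
    qed
    then show ?thesis by (simp add: regular[OF i j])
  qed
  have infl: "influence (iid_measure n p) u (family_rule n W) =
      d u (\<lambda>k. g (k - 1)) - ((\<Sum>S\<in>W. g (card S)) - d u g)" if u: "u \<in> {1..n}" for u
  proof -
    let ?A = "{S. S \<subseteq> {1..n} \<and> u \<notin> S \<and> S \<notin> W \<and> insert u S \<in> W}"
    let ?P = "{S. S \<subseteq> {1..n} \<and> (S \<in> W) \<noteq> ((if u \<in> S then S - {u} else insert u S) \<in> W)}"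
    have finA: "finite ?A" by (rule finite_subset[of _ "Pow {1..n}"]) auto
    have fins: "finite S" if "S \<subseteq> {1..n}" for S using that finite_subset by blast
    \<comment> \<open>Both members of a pivotal pair are counted. Upward closure forces the one
      containing \<open>u\<close> to be the winning one.\<close>
    have P: "?P = ?A \<union> insert u ` ?A"
    proof (intro equalityI subsetI)
      fix S assume S: "S \<in> ?P"
      show "S \<in> ?A \<union> insert u ` ?A"
      proof (cases "u \<in> S")
        case True
        have "S - {u} \<notin> W \<and> S \<in> W" using S True up[of "S - {u}" S] by auto
        then have "S - {u} \<in> ?A" "S = insert u (S - {u})" using S True by (auto simp: insert_absorb)
        then show ?thesis by blast
      next
        case False
        then show ?thesis using S u up[of S "insert u S"] by auto
      qed
    next
      fix S assume "S \<in> ?A \<union> insert u ` ?A"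
      then show "S \<in> ?P" using u by auto
    qed
    have "influence (iid_measure n p) u (family_rule n W) = (\<Sum>S\<in>?P. w (card S))"
      unfolding w_def by (rule influence_family_rule[OF p u])
    also have "\<dots> = (\<Sum>S\<in>?A. w (card S)) + (\<Sum>S\<in>insert u ` ?A. w (card S))"
      unfolding P using finA by (intro sum.union_disjoint) auto
    also have "(\<Sum>S\<in>insert u ` ?A. w (card S)) = (\<Sum>S\<in>?A. w (card (insert u S)))"
      by (intro sum.reindex[unfolded comp_def] inj_onI) (auto simp: insert_ident)
    also have "\<dots> = (\<Sum>S\<in>?A. w (Suc (card S)))"
      by (intro sum.cong) (auto simp: fins)
    also have "(\<Sum>S\<in>?A. w (card S)) + \<dots> = (\<Sum>S\<in>?A. g (card S))"
      by (simp add: g_def sum.distrib)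
    also have "?A = {S. S \<subseteq> {1..n} \<and> u \<notin> S \<and> insert u S \<in> W} - {S\<in>W. u \<notin> S}"
      by auto
    also have "(\<Sum>S\<in>\<dots>. g (card S)) =
        (\<Sum>S | S \<subseteq> {1..n} \<and> u \<notin> S \<and> insert u S \<in> W. g (card S)) - (\<Sum>S\<in>{S\<in>W. u \<notin> S}. g (card S))"
    proof (intro sum_diff)
      show "{S\<in>W. u \<notin> S} \<subseteq> {S. S \<subseteq> {1..n} \<and> u \<notin> S \<and> insert u S \<in> W}"
        using u W up[OF _ subset_insertI] by blast
    qed (auto intro: finite_subset[of _ "Pow {1..n}"])
    \<comment> \<open>Adding \<open>u\<close> maps these sets bijectively onto the winning sets
      through \<open>u\<close>, which are one larger; those are nonempty, so truncation in
      \<open>k - 1\<close> is harmless.\<close>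
    also have "(\<Sum>S | S \<subseteq> {1..n} \<and> u \<notin> S \<and> insert u S \<in> W. g (card S)) = d u (\<lambda>k. g (k - 1))"
      unfolding d_def
      by (rule sum.reindex_bij_witness[of _ "\<lambda>S. S - {u}" "insert u"])
        (use W fins in \<open>auto simp: insert_absorb\<close>)
    also have "{S\<in>W. u \<notin> S} = W - {S\<in>W. u \<in> S}" by auto
    also have "(\<Sum>S\<in>\<dots>. g (card S)) = (\<Sum>S\<in>W. g (card S)) - d u g"
      unfolding d_def using finW by (intro sum_diff) auto
    finally show ?thesis .
  qed
  show "influence (iid_measure n p) i (family_rule n W) = influence (iid_measure n p) j (family_rule n W)"
    unfolding infl[OF i] infl[OF j] d_eq ..
qed

lemma family_rule_voting_rule: "voting_rule n (family_rule n W)"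
  by (auto simp: voting_rule_def family_rule_def)

lemma family_rule_odd:
  assumes "\<And>S. S \<subseteq> {1..n} \<Longrightarrow> {1..n} - S \<in> W \<longleftrightarrow> S \<notin> W"
  shows "odd_rule n (family_rule n W)"
  unfolding odd_rule_def
proof
  fix x assume x: "x \<in> cube n"
  have "ones n (cube_neg n x) = {1..n} - ones n x"
    using cube_val[OF x] by (force simp: cube_neg_def ones_def)
  then show "family_rule n W (cube_neg n x) = - family_rule n W x"
    unfolding family_rule_def using assms[OF ones_subset, of x] by auto
qed

lemma family_rule_monotone:
  assumes up: "\<And>S T. S \<in> W \<Longrightarrow> S \<subseteq> T \<Longrightarrow> T \<subseteq> {1..n} \<Longrightarrow> T \<in> W"
  shows "monotone_rule n (family_rule n W)"
  unfolding monotone_rule_def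
proof (intro ballI impI)
  fix x x' assume x: "x \<in> cube n" and x': "x' \<in> cube n" and ge: "\<forall>i\<in>{1..n}. x i \<ge> x' i"
  have "ones n x' \<subseteq> ones n x"
    using ge cube_val[OF x] by (force simp: ones_def)
  then show "family_rule n W x \<ge> family_rule n W x'"
    unfolding family_rule_def using up[OF _ _ ones_subset] by auto
qed

lemma family_rule_winning_coalition:
  assumes odd: "\<And>S. S \<subseteq> {1..n} \<Longrightarrow> {1..n} - S \<in> W \<longleftrightarrow> S \<notin> W"
    and up: "\<And>S T. S \<in> W \<Longrightarrow> S \<subseteq> T \<Longrightarrow> T \<subseteq> {1..n} \<Longrightarrow> T \<in> W"
    and S: "S \<in> W" "S \<subseteq> {1..n}"
  shows "winning_coalition n (family_rule n W) S"
  unfolding winning_coalition_def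
proof (intro conjI ballI impI S)
  fix y :: int and x assume y: "y \<in> {-1, 1}" and x: "x \<in> cube n" and xS: "\<forall>i\<in>S. x i = y"
  let ?T = "ones n x"
  show "family_rule n W x = y"
  proof (cases "y = 1")
    case True
    then have "S \<subseteq> ?T" using xS S by (auto simp: ones_def)
    then show ?thesis using up[OF S(1) _ ones_subset] True by (auto simp: family_rule_def)
  next
    \<comment> \<open>For \<open>y = -1\<close> the complement of the ones contains \<open>S\<close>
      and wins, so by self-duality the ones lose.\<close>
    case False
    then have "S \<subseteq> {1..n} - ?T" using xS S y by (auto simp: ones_def)
    then have "{1..n} - ?T \<in> W" using up[OF S(1)] by blast
    then show ?thesis using odd[OF ones_subset, of x] False y by (auto simp: family_rule_def)
  qed
qed

lemma aut_family_rule: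
  assumes \<rho>: "\<rho> \<in> aut n (family_rule n W)" and S: "S \<subseteq> {1..n}"
  shows "\<rho> ` S \<in> W \<longleftrightarrow> S \<in> W"
proof -
  have perm: "\<rho> permutes {1..n}" using \<rho> by (simp add: aut_def)
  have sub: "\<rho> ` S \<subseteq> {1..n}" using S permutes_in_image[OF perm] by auto
  let ?x = "indicator_point n (\<rho> ` S)"
  \<comment> \<open>The two inverses in \<open>perm_rule\<close> and \<open>perm_point\<close>
    cancel, so the permuted rule evaluates at \<open>x \<circ> \<rho>\<close>; for the indicator of
    the image of \<open>S\<close> this is the indicator of \<open>S\<close>.\<close>
  have "inv_into UNIV (inv_into UNIV \<rho>) = \<rho>" using perm by (rule permutes_inv_inv)
  then have "family_rule n W (?x \<circ> \<rho>) = family_rule n W ?x"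
    using \<rho> indicator_point_cube by (auto simp: aut_def perm_rule_def perm_point_def)
  moreover have "ones n (?x \<circ> \<rho>) = S"
    using S permutes_in_image[OF perm] permutes_inj[OF perm]
    by (auto simp: ones_def indicator_point_def inj_image_mem_iff)
  ultimately show ?thesis
    using sub by (auto simp: family_rule_def ones_indicator_point split: if_splits)
qed

section \<open>Perturbed majority\<close>

text \<open>\<open>\<B>\<close> holds the coalitions that override majority, and \<open>\<S>\<close>
  the minority sets to be promoted. \<open>S_neutral\<close> keeps the two modifications apart,
  \<open>S_inter\<close> serves monotonicity, and \<open>B_trans\<close> with
  \<open>S_regular\<close> serves unbiasedness.\<close>

locale coalition_system =
  fixes V :: "'a set" and \<B> \<S> :: "'a set set" and k :: nat
  assumes finite_V: "finite V" and card_V: "card V = 2 * k + 1"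
    and B_sub: "B \<in> \<B> \<Longrightarrow> B \<subseteq> V"
    and B_inter: "B \<in> \<B> \<Longrightarrow> B' \<in> \<B> \<Longrightarrow> B \<inter> B' \<noteq> {}"
    and B_small: "B \<in> \<B> \<Longrightarrow> card B < k"
    and B_trans: "u \<in> V \<Longrightarrow> v \<in> V \<Longrightarrow> \<exists>g. bij_betw g V V \<and> g u = v \<and> (\<forall>B\<in>\<B>. g ` B \<in> \<B>)"
    and S_sub: "S \<in> \<S> \<Longrightarrow> S \<subseteq> V"
    and S_card: "S \<in> \<S> \<Longrightarrow> card S = k"
    and S_inter: "S \<in> \<S> \<Longrightarrow> S' \<in> \<S> \<Longrightarrow> S \<inter> S' \<noteq> {}"
    and S_neutral: "S \<in> \<S> \<Longrightarrow> B \<in> \<B> \<Longrightarrow> B - S \<noteq> {} \<and> B \<inter> S \<noteq> {}"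
    and S_regular: "u \<in> V \<Longrightarrow> v \<in> V \<Longrightarrow> card {S\<in>\<S>. u \<in> S} = card {S\<in>\<S>. v \<in> S}"
begin

definition covers :: "'a set \<Rightarrow> bool" where
  "covers T \<longleftrightarrow> (\<exists>B\<in>\<B>. B \<subseteq> T)"

text \<open>Demoting the complements of \<open>\<S>\<close>, which have size \<open>k + 1\<close>,
  compensates for the promotion and keeps the family self-dual.\<close>

definition W :: "'a set set" where
  "W = {T. T \<subseteq> V \<and> (covers T \<or> \<not> covers (V - T) \<and> (T \<in> \<S> \<or> k < card T \<and> V - T \<notin> \<S>))}"

lemma W_sub: "T \<in> W \<Longrightarrow> T \<subseteq> V"
  by (simp add: W_def)

lemma covers_mono: "covers S \<Longrightarrow> S \<subseteq> T \<Longrightarrow> covers T"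
  by (auto simp: covers_def)

lemma covers_compl: "covers T \<Longrightarrow> \<not> covers (V - T)"
  unfolding covers_def using B_inter by blast

lemma covers_imp_W: "T \<subseteq> V \<Longrightarrow> covers T \<Longrightarrow> T \<in> W"
  by (simp add: W_def)

lemma finite_sub: "T \<subseteq> V \<Longrightarrow> finite T"
  using finite_V finite_subset by blast

lemma card_compl: "T \<subseteq> V \<Longrightarrow> card (V - T) = 2 * k + 1 - card T"
  using finite_sub card_V by (simp add: card_Diff_subset)

lemma card_le: "T \<subseteq> V \<Longrightarrow> card T \<le> 2 * k + 1"
  using card_mono[OF finite_V] card_V by metis

text \<open>A set and its complement cannot both be covered, by \<open>B_inter\<close>, nor both lie
  in \<open>\<S>\<close>, as their sizes add up to an odd number.\<close>

lemma W_compl: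
  assumes T: "T \<subseteq> V"
  shows "V - T \<in> W \<longleftrightarrow> T \<notin> W"
proof -
  have d: "V - (V - T) = T" using T by blast
  have c: "card (V - T) = 2 * k + 1 - card T" "card T \<le> 2 * k + 1"
    using T card_compl card_le by auto
  have "T \<in> \<S> \<Longrightarrow> V - T \<notin> \<S>" using c S_card[of T] S_card[of "V - T"] by auto
  moreover have "T \<in> \<S> \<Longrightarrow> card T = k" "V - T \<in> \<S> \<Longrightarrow> card T = k + 1"
    using c S_card[of T] S_card[of "V - T"] by auto
  ultimately show ?thesis
    using T c covers_compl[of T] covers_compl[of "V - T"] unfolding W_def by (auto simp: d)
qed

text \<open>The critical case is a superset \<open>T\<close> whose complement was promoted. Then
  \<open>T\<close> has size \<open>k + 1\<close>, so a smaller winning uncovered \<open>S\<close>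
  lies in \<open>\<S>\<close> and is disjoint from \<open>V - T\<close>, against
  \<open>S_inter\<close>.\<close>

lemma W_up:
  assumes S: "S \<in> W" and ST: "S \<subseteq> T" and T: "T \<subseteq> V"
  shows "T \<in> W"
proof (cases "covers T")
  case True
  then show ?thesis using T by (simp add: W_def)
next
  case False
  then have nS: "\<not> covers S" using ST covers_mono by blast
  then have nc: "\<not> covers (V - S)" and dis: "S \<in> \<S> \<or> k < card S \<and> V - S \<notin> \<S>"
    using S by (auto simp: W_def)
  have nT: "\<not> covers (V - T)" using nc ST covers_mono by (meson Diff_mono subset_refl)
  show ?thesis
  proof (cases "S = T")
    case False
    then have "S \<subset> T" using ST by blast
    then have lt: "card S < card T" using T finite_sub by (simp add: psubset_card_mono)
    have k: "k < card T" using lt dis S_card by force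
    have "V - T \<notin> \<S>"
    proof
      assume VT: "V - T \<in> \<S>"
      then have "card T = k + 1" using card_compl[OF T] card_le[OF T] S_card[OF VT] by simp
      then have "S \<in> \<S>" using lt dis by auto
      then show False using S_inter[OF _ VT] ST by blast
    qed
    then show ?thesis using T nT k by (simp add: W_def)
  qed (use S in simp)
qed

text \<open>A symmetry of \<open>\<B>\<close> taking \<open>u\<close> to \<open>v\<close> injects
  the sets through \<open>u\<close> into those through \<open>v\<close>; exchanging the roles gives
  equality. It is applied to \<open>covers\<close> and to the family of all subsets.\<close>

lemma card_invariant_level:
  assumes P: "\<And>g T. bij_betw g V V \<Longrightarrow> \<forall>B\<in>\<B>. g ` B \<in> \<B> \<Longrightarrow> T \<subseteq> V \<Longrightarrow> P T \<Longrightarrow> P (g ` T)"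
    and u: "u \<in> V" and v: "v \<in> V"
  shows "card {T. T \<subseteq> V \<and> P T \<and> card T = j \<and> u \<in> T} = card {T. T \<subseteq> V \<and> P T \<and> card T = j \<and> v \<in> T}"
proof -
  have le: "card {T. T \<subseteq> V \<and> P T \<and> card T = j \<and> u \<in> T} \<le> card {T. T \<subseteq> V \<and> P T \<and> card T = j \<and> v \<in> T}"
    if u: "u \<in> V" and v: "v \<in> V" for u v
  proof -
    obtain g where g: "bij_betw g V V" "g u = v" and gB: "\<forall>B\<in>\<B>. g ` B \<in> \<B>"
      using B_trans[OF u v] by blast
    have inj: "inj_on g V" and im: "g ` V = V" using g by (auto simp: bij_betw_def)
    show ?thesis
    proof (rule card_inj_on_le[where f = "(`) g"])
      show "inj_on ((`) g) {T. T \<subseteq> V \<and> P T \<and> card T = j \<and> u \<in> T}"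
        using inj_on_image_Pow[OF inj] by (rule inj_on_subset) blast
      show "(`) g ` {T. T \<subseteq> V \<and> P T \<and> card T = j \<and> u \<in> T} \<subseteq> {T. T \<subseteq> V \<and> P T \<and> card T = j \<and> v \<in> T}"
      proof clarify
        fix T assume T: "T \<subseteq> V" "P T" "u \<in> T"
        have "card (g ` T) = card T" using inj T(1) by (metis card_image inj_on_subset)
        then show "g ` T \<subseteq> V \<and> P (g ` T) \<and> card (g ` T) = card T \<and> v \<in> g ` T"
          using T im g(2) P[OF g(1) gB T(1,2)] by blast
      qed
    qed (auto intro: finite_subset[of _ "Pow V"] simp: finite_V)
  qed
  show ?thesis using le[OF u v] le[OF v u] by simp
qed

lemma card_covers_level:
  assumes u: "u \<in> V" and v: "v \<in> V"
  shows "card {T. T \<subseteq> V \<and> covers T \<and> card T = j \<and> u \<in> T} = card {T. T \<subseteq> V \<and> covers T \<and> card T = j \<and> v \<in> T}"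
  by (rule card_invariant_level[OF _ u v]) (unfold covers_def, meson image_mono)

lemma finite_family: "(\<And>T. T \<in> A \<Longrightarrow> T \<subseteq> V) \<Longrightarrow> finite A"
  by (rule finite_subset[of _ "Pow V"]) (auto simp: finite_V)

text \<open>Up to size \<open>k\<close> majority contributes nothing: winning sets are covered ones
  and, at size \<open>k\<close>, the members of \<open>\<S>\<close>. By \<open>S_neutral\<close>
  these kinds are disjoint.\<close>

lemma W_regular_low:
  assumes u: "u \<in> V" and v: "v \<in> V" and j: "j \<le> k"
  shows "card {T\<in>W. card T = j \<and> u \<in> T} = card {T\<in>W. card T = j \<and> v \<in> T}"
proof -
  have *: "card {T\<in>W. card T = j \<and> u \<in> T} =
      card {T. T \<subseteq> V \<and> covers T \<and> card T = j \<and> u \<in> T} + (if j = k then card {S\<in>\<S>. u \<in> S} else 0)" for u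
  proof -
    let ?A = "{T. T \<subseteq> V \<and> covers T \<and> card T = j \<and> u \<in> T}"
    let ?C = "if j = k then {S\<in>\<S>. u \<in> S} else {}"
    have 1: "\<not> covers S \<and> \<not> covers (V - S)" if "S \<in> \<S>" for S
      using S_neutral[OF that] unfolding covers_def by blast
    have "{T\<in>W. card T = j \<and> u \<in> T} = ?A \<union> ?C"
      using j 1 S_sub S_card by (auto simp: W_def)
    moreover have "?A \<inter> ?C = {}" using 1 by auto
    moreover have "finite ?A" "finite ?C" by (rule finite_family; use S_sub in \<open>auto split: if_splits\<close>)+
    ultimately show ?thesis by (simp add: card_Un_disjoint)
  qed
  show ?thesis unfolding * by (simp add: card_covers_level[OF u v] S_regular[OF u v])
qed

lemma W_regular:
  assumes u: "u \<in> V" and v: "v \<in> V"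
  shows "card {T\<in>W. card T = j \<and> u \<in> T} = card {T\<in>W. card T = j \<and> v \<in> T}"
proof (cases "j \<le> k \<or> 2 * k + 1 < j")
  case True
  then show ?thesis
  proof
    assume "2 * k + 1 < j"
    then have "{T\<in>W. card T = j \<and> u \<in> T} = {}" "{T\<in>W. card T = j \<and> v \<in> T} = {}"
      using card_le W_sub by (auto simp: not_le[symmetric])
    then show ?thesis by (simp only:)
  qed (rule W_regular_low[OF u v])
next
  case False
  define l where "l = 2 * k + 1 - j"
  have l: "l \<le> k" "j = 2 * k + 1 - l" "l \<le> 2 * k + 1" using False by (auto simp: l_def)
  \<comment> \<open>Complementation turns winning sets through \<open>u\<close> at level
    \<open>j\<close> into losing sets avoiding \<open>u\<close> at the low level \<open>l\<close>;
    the identity counts these by subtraction, written additively. The conjunct \<open>True\<close>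
    matches the predicate of \<open>card_invariant_level\<close>.\<close>
  have *: "card {T\<in>W. card T = j \<and> u \<in> T} + card {T\<in>W. card T = l} + card {T. T \<subseteq> V \<and> True \<and> card T = l \<and> u \<in> T} =
     card {T. T \<subseteq> V \<and> card T = l} + card {T\<in>W. card T = l \<and> u \<in> T}" if u: "u \<in> V" for u
  proof -
    have "card {T\<in>W. card T = j \<and> u \<in> T} = card {T. T \<subseteq> V \<and> card T = l \<and> u \<notin> T \<and> T \<notin> W}"
    proof (rule bij_betw_same_card[OF bij_betwI[where f = "\<lambda>T. V - T" and g = "\<lambda>T. V - T"]])
      show "(\<lambda>T. V - T) \<in> {T\<in>W. card T = j \<and> u \<in> T} \<rightarrow> {T. T \<subseteq> V \<and> card T = l \<and> u \<notin> T \<and> T \<notin> W}"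
        using W_sub W_compl l by (auto simp: card_compl)
      show "(\<lambda>T. V - T) \<in> {T. T \<subseteq> V \<and> card T = l \<and> u \<notin> T \<and> T \<notin> W} \<rightarrow> {T\<in>W. card T = j \<and> u \<in> T}"
        using W_compl l u by (auto simp: card_compl)
    qed (use W_sub in \<open>auto simp: double_diff\<close>)
    moreover have "card {T. T \<subseteq> V \<and> card T = l} = card {T. T \<subseteq> V \<and> card T = l \<and> u \<notin> T \<and> T \<notin> W} +
      card {T\<in>W. card T = l \<and> u \<notin> T} + card {T. T \<subseteq> V \<and> True \<and> card T = l \<and> u \<in> T}"
    proof -
      have "{T. T \<subseteq> V \<and> card T = l} = ({T. T \<subseteq> V \<and> card T = l \<and> u \<notin> T \<and> T \<notin> W} \<union>
        {T\<in>W. card T = l \<and> u \<notin> T}) \<union> {T. T \<subseteq> V \<and> True \<and> card T = l \<and> u \<in> T}"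
        using W_sub by auto
      then show ?thesis
        by (simp only:) (subst card_Un_disjoint; (subst card_Un_disjoint)?; (rule finite_family)?; use W_sub in auto)
    qed
    moreover have "card {T\<in>W. card T = l} = card {T\<in>W. card T = l \<and> u \<in> T} + card {T\<in>W. card T = l \<and> u \<notin> T}"
      by (subst card_Un_disjoint[symmetric]; (rule finite_family)?; use W_sub in \<open>auto intro!: arg_cong[where f = card]\<close>)
    ultimately show ?thesis by linarith
  qed
  have "card {T. T \<subseteq> V \<and> True \<and> card T = l \<and> u \<in> T} = card {T. T \<subseteq> V \<and> True \<and> card T = l \<and> v \<in> T}"
    by (rule card_invariant_level[OF _ u v]) simp
  then show ?thesis using *[OF u] *[OF v] W_regular_low[OF u v l(1)] by linarith
qed

section \<open>Automorphisms and an invariant that distinguishes elements\<close>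

text \<open>This recovers \<open>\<S>\<close> from \<open>W\<close>, so automorphisms of \<open>W\<close> preserve \<open>\<S>\<close>.\<close>

lemma S_iff_minimal: "S \<in> \<S> \<longleftrightarrow> S \<in> W \<and> card S = k \<and> (\<forall>x\<in>S. S - {x} \<notin> W)"
proof
  assume S: "S \<in> \<S>"
  have nc: "\<not> covers S" "\<not> covers (V - S)" using S_neutral[OF S] unfolding covers_def by blast+
  have "S - {x} \<notin> W" if x: "x \<in> S" for x
  proof -
    have "card (S - {x}) < k" using S_card[OF S] S_sub[OF S] x finite_sub by (metis card_Diff1_less)
    moreover have "\<not> covers (S - {x})" using nc covers_mono by blast
    ultimately show ?thesis using S_card by (auto simp: W_def)
  qed
  then show "S \<in> W \<and> card S = k \<and> (\<forall>x\<in>S. S - {x} \<notin> W)"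
    using S S_sub S_card nc by (auto simp: W_def)
next
  assume S: "S \<in> W \<and> card S = k \<and> (\<forall>x\<in>S. S - {x} \<notin> W)"
  \<comment> \<open>A coalition inside \<open>S\<close> has fewer than \<open>k\<close> elements, so
    some element of \<open>S\<close> could be dropped with the rest still covered and winning,
    against minimality.\<close>
  have "\<not> covers S"
  proof
    assume "covers S"
    then obtain B where B: "B \<in> \<B>" "B \<subseteq> S" by (auto simp: covers_def)
    then have "card B < card S" using B_small S by auto
    then obtain x where x: "x \<in> S" "x \<notin> B" using B by (metis less_irrefl subsetI subset_antisym)
    then have "covers (S - {x})" using B by (auto simp: covers_def)
    then show False using S x W_sub covers_imp_W by (metis Diff_subset subset_trans)
  qed
  then show "S \<in> \<S>" using S by (auto simp: W_def)
qed

text \<open>A property stated through \<open>\<S>\<close> and \<open>V\<close> alone, hence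
  preserved by automorphisms of \<open>W\<close>; one element with it and one without it rule out
  transitivity.\<close>

definition exchangeable :: "'a \<Rightarrow> bool" where
  "exchangeable u \<longleftrightarrow> (\<exists>S\<in>\<S>. \<exists>v\<in>V - S. u \<in> S \<and> insert v (S - {u}) \<in> \<S>)"

lemma automorphism_S:
  assumes \<tau>: "bij_betw \<tau> V V" and W: "\<And>T. T \<subseteq> V \<Longrightarrow> \<tau> ` T \<in> W \<longleftrightarrow> T \<in> W" and S: "S \<in> \<S>"
  shows "\<tau> ` S \<in> \<S>"
proof -
  have inj: "inj_on \<tau> V" using \<tau> by (simp add: bij_betw_def)
  have sub: "S \<subseteq> V" using S_sub[OF S] .
  have "\<tau> ` S \<in> W" "card (\<tau> ` S) = k"
    using S S_iff_minimal[of S] W[OF sub] card_image[OF inj_on_subset[OF inj sub]] by auto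
  moreover have "\<tau> ` S - {\<tau> x} \<notin> W" if x: "x \<in> S" for x
  proof -
    have "\<tau> ` S - {\<tau> x} = \<tau> ` (S - {x})"
      using inj_on_image_set_diff[OF inj, of S "{x}"] sub x by auto
    then show ?thesis using W[of "S - {x}"] sub x S S_iff_minimal[of S] by auto
  qed
  ultimately show ?thesis using S_iff_minimal[of "\<tau> ` S"] by auto
qed

lemma automorphism_exchangeable:
  assumes \<tau>: "bij_betw \<tau> V V" and W: "\<And>T. T \<subseteq> V \<Longrightarrow> \<tau> ` T \<in> W \<longleftrightarrow> T \<in> W" and u: "exchangeable u"
  shows "exchangeable (\<tau> u)"
proof -
  obtain S v where S: "S \<in> \<S>" "v \<in> V - S" "u \<in> S" "insert v (S - {u}) \<in> \<S>"
    using u by (auto simp: exchangeable_def)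
  have inj: "inj_on \<tau> V" and im: "\<tau> ` V = V" using \<tau> by (auto simp: bij_betw_def)
  have sub: "S \<subseteq> V" using S_sub S by blast
  have "\<tau> ` insert v (S - {u}) = insert (\<tau> v) (\<tau> ` S - {\<tau> u})"
    using inj_on_image_set_diff[OF inj, of S "{u}"] sub S(3) by auto
  moreover have "\<tau> v \<in> V - \<tau> ` S"
    using S(2) im inj_on_image_mem_iff[OF inj _ sub, of v] by auto
  ultimately show ?thesis
    unfolding exchangeable_def
    using automorphism_S[OF \<tau> W S(1)] automorphism_S[OF \<tau> W S(4)] S(3)
    by (intro bexI[of _ "\<tau> ` S"] bexI[of _ "\<tau> v"]) auto
qed

end

section \<open>Coalitions over a projective plane\<close>

text \<open>Ordinary shapes are intervals; \<open>[1, 3, 4, 5, 9]\<close> are the nonzero squares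
  modulo 11. The special six-element shape is chosen so that no translate contains a translate of
  the squares or is the complement of one, and distinct translates differ in at least two elements
  each way.\<close>

definition shape :: "bool \<Rightarrow> bool \<Rightarrow> nat list" where
  "shape special six =
    (if special then if six then [0, 1, 2, 3, 4, 6] else [1, 3, 4, 5, 9]
     else if six then [0, 1, 2, 3, 4, 5] else [0, 1, 2, 3, 4])"

text \<open>Lists make the finitely many facts about rotations modulo 11 decidable by
  evaluation.\<close>

definition fibre_list :: "bool \<Rightarrow> bool \<Rightarrow> nat \<Rightarrow> nat list" where
  "fibre_list special six t = map (\<lambda>x. (x + t) mod 11) (shape special six)"

definition fibre :: "bool \<Rightarrow> bool \<Rightarrow> nat \<Rightarrow> nat set" where
  "fibre special six t = set (fibre_list special six t)"

lemma fibre_sub: "fibre a b t \<subseteq> {..<11}"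
  by (auto simp: fibre_def fibre_list_def)

lemma finite_fibre: "finite (fibre a b t)"
  by (simp add: fibre_def)

lemma fibre_mod: "fibre a b (t mod 11) = fibre a b t"
  by (simp add: fibre_def fibre_list_def mod_add_right_eq)

lemma fibre_shift: "(\<lambda>y. (y + s) mod 11) ` fibre a b t = fibre a b ((t + s) mod 11)"
  unfolding fibre_mod by (simp add: fibre_def fibre_list_def image_image mod_simps add.assoc)

lemma card_fibre:
  assumes "t < 11"
  shows "card (fibre a b t) = (if b then 6 else 5)"
proof -
  have "\<forall>a\<in>set [False, True]. \<forall>b\<in>set [False, True]. \<forall>t\<in>set [0..<11].
      distinct (fibre_list a b t) \<and> length (fibre_list a b t) = (if b then 6 else 5)"
    by code_simp
  then show ?thesis using assms by (cases a; cases b) (auto simp: fibre_def distinct_card)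
qed

text \<open>Two translates of the difference set meet; two six-element sets meet as
  \<open>6 + 6 > 11\<close>; in the mixed case, disjoint sets would be complementary, which the
  choice of shape prevents.\<close>

lemma fibre_special_inter:
  assumes "s < 11" "t < 11"
  shows "fibre True a s \<inter> fibre True b t \<noteq> {}"
proof -
  have "\<forall>a\<in>set [False, True]. \<forall>b\<in>set [False, True]. \<forall>s\<in>set [0..<11]. \<forall>t\<in>set [0..<11].
      \<exists>x\<in>set (fibre_list True a s). x \<in> set (fibre_list True b t)"
    by code_simp
  then have "\<exists>x\<in>fibre True a s. x \<in> fibre True b t"
    using assms by (cases a; cases b) (auto simp: fibre_def)
  then show ?thesis by blast
qed

lemma fibre_special_diff:
  assumes "s < 11" "t < 11" "s \<noteq> t"
  shows "2 \<le> card (fibre True a s - fibre True a t)"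
proof -
  have "\<forall>a\<in>set [False, True]. \<forall>s\<in>set [0..<11]. \<forall>t\<in>set [0..<11]. s \<noteq> t \<longrightarrow>
      2 \<le> length (filter (\<lambda>x. x \<notin> set (fibre_list True a t)) (fibre_list True a s)) \<and>
      distinct (fibre_list True a s)"
    by code_simp
  then have *: "2 \<le> length (filter (\<lambda>x. x \<notin> fibre True a t) (fibre_list True a s))"
      "distinct (fibre_list True a s)"
    using assms by (cases a; auto simp: fibre_def)+
  have "fibre True a s - fibre True a t = set (filter (\<lambda>x. x \<notin> fibre True a t) (fibre_list True a s))"
    by (auto simp: fibre_def)
  then show ?thesis using * by (metis distinct_card distinct_filter)
qed

lemma fibre_special_not_subset:
  assumes "s < 11" "t < 11"
  shows "\<not> fibre True False s \<subseteq> fibre True True t"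
proof -
  have "\<forall>s\<in>set [0..<11]. \<forall>t\<in>set [0..<11]. \<exists>x\<in>set (fibre_list True False s). x \<notin> set (fibre_list True True t)"
    by code_simp
  then have "\<exists>x\<in>fibre True False s. x \<notin> fibre True True t"
    using assms by (auto simp: fibre_def)
  then show ?thesis by blast
qed

text \<open>A translate of the squares is not an interval, so it is neither inside nor disjoint from
  an interval of length 5 or 6. This yields \<open>S_neutral\<close> over ordinary points.\<close>

lemma fibre_ordinary_neutral:
  assumes "s < 11" "t < 11"
  shows "fibre True False s - fibre False b t \<noteq> {}" "fibre True False s \<inter> fibre False b t \<noteq> {}"
proof -
  have "\<forall>b\<in>set [False, True]. \<forall>s\<in>set [0..<11]. \<forall>t\<in>set [0..<11].
      (\<exists>x\<in>set (fibre_list True False s). x \<notin> set (fibre_list False b t)) \<and>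
      (\<exists>x\<in>set (fibre_list True False s). x \<in> set (fibre_list False b t))"
    by code_simp
  then have "(\<exists>x\<in>fibre True False s. x \<notin> fibre False b t) \<and> (\<exists>x\<in>fibre True False s. x \<in> fibre False b t)"
    using assms by (cases b) (auto simp: fibre_def)
  then show "fibre True False s - fibre False b t \<noteq> {}" "fibre True False s \<inter> fibre False b t \<noteq> {}"
    by blast+
qed

lemma fibre_inj:
  assumes "s < 11" "t < 11" "fibre a b s = fibre a b t"
  shows "s = t"
proof -
  have "\<forall>a\<in>set [False, True]. \<forall>b\<in>set [False, True]. \<forall>s\<in>set [0..<11]. \<forall>t\<in>set [0..<11]. s \<noteq> t \<longrightarrow>
      (\<exists>x\<in>set (fibre_list a b s). x \<notin> set (fibre_list a b t))"
    by code_simp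
  then have "s \<noteq> t \<Longrightarrow> \<exists>x\<in>fibre a b s. x \<notin> fibre a b t"
    using assms(1,2) by (cases a; cases b) (auto simp: fibre_def)
  then show ?thesis using assms(3) by blast
qed

text \<open>The count depends only on the size of the shape, which is why special shapes leave the
  incidence numbers of \<open>\<S>\<close> unchanged.\<close>

lemma card_fibre_index:
  assumes "j < 11"
  shows "card {t\<in>{..<11}. j \<in> fibre a b t} = (if b then 6 else 5)"
proof -
  have "\<forall>a\<in>set [False, True]. \<forall>b\<in>set [False, True]. \<forall>j\<in>set [0..<11].
      length (filter (\<lambda>t. j \<in> set (fibre_list a b t)) [0..<11]) = (if b then 6 else 5)"
    by code_simp
  then have "length (filter (\<lambda>t. j \<in> fibre a b t) [0..<11]) = (if b then 6 else 5)"
    using assms by (cases a; cases b) (auto simp: fibre_def)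
  moreover have "{t\<in>{..<11}. j \<in> fibre a b t} = set (filter (\<lambda>t. j \<in> fibre a b t) [0..<11])"
    by auto
  ultimately show ?thesis by (simp only: distinct_card distinct_filter distinct_upt)
qed

lemma fibre_ordinary_step: "fibre False False 1 = insert 5 (fibre False False 0 - {0})"
  by (auto simp: fibre_def fibre_list_def shape_def)

lemma fibre_ordinary_0: "fibre False False 0 = {0, 1, 2, 3, 4}"
  by (auto simp: fibre_def fibre_list_def shape_def)


locale blown_up_plane =
  fixes q m h :: nat and \<L> :: "nat set set"
  assumes q_gt_1: "q > 1" and m: "m = q ^ 2 + q + 1" and h: "m = 2 * h + 1"
    and L_sub: "l \<in> \<L> \<Longrightarrow> l \<subseteq> {..<m}"
    and L_card: "l \<in> \<L> \<Longrightarrow> card l = q + 1"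
    and L_inter: "l \<in> \<L> \<Longrightarrow> l' \<in> \<L> \<Longrightarrow> l \<inter> l' \<noteq> {}"
    and L_trans: "u < m \<Longrightarrow> v < m \<Longrightarrow>
      \<exists>g. bij_betw g {..<m} {..<m} \<and> g u = v \<and> (\<forall>l\<in>\<L>. g ` l \<in> \<L>)"
begin

definition V :: "(nat \<times> nat) set" where
  "V = {..<m} \<times> {..<11}"

definition block :: "nat set \<Rightarrow> nat \<Rightarrow> (nat \<times> nat) set" where
  "block l t = l \<times> fibre True False t"

definition \<B> :: "(nat \<times> nat) set set" where
  "\<B> = {block l t | l t. l \<in> \<L> \<and> t < 11}"

text \<open>
  \<open>Q\<close> is the set of points with six voters, \<open>t\<close> gives the rotations, and the special point is 0.
\<close>

definition wave :: "nat set \<Rightarrow> (nat \<Rightarrow> nat) \<Rightarrow> (nat \<times> nat) set" where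
  "wave Q t = (SIGMA c:{..<m}. fibre (c = 0) (c \<in> Q) (t c))"

text \<open>With \<open>h\<close> fibres of six voters a wave has
  \<open>5 * m + h = 11 * h + 5\<close> elements, just under half of \<open>11 * m\<close>. Letting
  all rotations vary independently is what makes \<open>\<S>\<close> regular.\<close>

definition params :: "(nat set \<times> (nat \<Rightarrow> nat)) set" where
  "params = {Q. Q \<subseteq> {..<m} \<and> card Q = h} \<times> ({..<m} \<rightarrow>\<^sub>E {..<11})"

definition \<S> :: "(nat \<times> nat) set set" where
  "\<S> = (\<lambda>(Q, t). wave Q t) ` params"

lemma h_pos: "h \<ge> 1"
proof -
  have "q ^ 2 \<ge> 2 ^ 2" using q_gt_1 by (intro power_mono) auto
  then show ?thesis using m h by simp
qed

lemma wave_fibre: "c < m \<Longrightarrow> {j. (c, j) \<in> wave Q t} = fibre (c = 0) (c \<in> Q) (t c)"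
  by (auto simp: wave_def)

lemma params_less: "(Q, t) \<in> params \<Longrightarrow> c < m \<Longrightarrow> t c < 11"
  by (auto simp: params_def PiE_def Pi_def)

lemma wave_sub: "wave Q t \<subseteq> V"
  using fibre_sub by (auto simp: wave_def V_def subset_iff)

lemma SE:
  assumes "S \<in> \<S>"
  obtains Q t where "(Q, t) \<in> params" "S = wave Q t"
  using assms by (auto simp: \<S>_def)

lemma card_wave:
  assumes "(Q, t) \<in> params"
  shows "card (wave Q t) = 11 * h + 5"
proof -
  have Q: "Q \<subseteq> {..<m}" "card Q = h" using assms by (auto simp: params_def)
  have "card (wave Q t) = (\<Sum>c<m. card (fibre (c = 0) (c \<in> Q) (t c)))"
    unfolding wave_def by (intro card_SigmaI) (auto simp: finite_fibre)
  also have "\<dots> = (\<Sum>c<m. 5 + (if c \<in> Q then 1 else 0))"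
    using params_less[OF assms] by (intro sum.cong) (auto simp: card_fibre)
  also have "\<dots> = 5 * m + h"
    using Q by (simp add: sum.distrib sum.If_cases Int_absorb1)
  finally show ?thesis using h by simp
qed

text \<open>The size of a fibre reveals whether its point is in \<open>Q\<close>, and the fibre then
  determines its rotation.\<close>

lemma inj_wave: "inj_on (\<lambda>(Q, t). wave Q t) params"
proof (rule inj_onI, clarify)
  fix Q t Q' t' assume p: "(Q, t) \<in> params" and p': "(Q', t') \<in> params" and eq: "wave Q t = wave Q' t'"
  have *: "(c \<in> Q \<longleftrightarrow> c \<in> Q') \<and> t c = t' c" if c: "c < m" for c
  proof -
    have f: "fibre (c = 0) (c \<in> Q) (t c) = fibre (c = 0) (c \<in> Q') (t' c)"
      using wave_fibre[OF c, of Q t] wave_fibre[OF c, of Q' t'] eq by simp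
    have "c \<in> Q \<longleftrightarrow> c \<in> Q'"
      using arg_cong[OF f, of card] params_less[OF p c] params_less[OF p' c]
      by (simp add: card_fibre split: if_splits)
    then show ?thesis
      using f fibre_inj[OF params_less[OF p c] params_less[OF p' c], of "c = 0" "c \<in> Q"] by simp
  qed
  have "Q = Q'" using * p p' by (auto simp: params_def)
  moreover have "t = t'"
    using * p p' by (intro PiE_ext[of t "{..<m}" "\<lambda>_. {..<11}" t']) (auto simp: params_def)
  ultimately show "Q = Q' \<and> t = t'" ..
qed

text \<open>For fixed \<open>Q\<close>, the rotation at \<open>c\<close> has 6 or 5 admissible
  values and the other \<open>m - 1\<close> rotations are free.\<close>

lemma card_params_through:
  assumes c: "c < m" and j: "j < 11"
  shows "card {S\<in>\<S>. (c, j) \<in> S} =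
    (\<Sum>Q | Q \<subseteq> {..<m} \<and> card Q = h. (if c \<in> Q then 6 else 5) * 11 ^ (m - 1))"
proof -
  let ?T = "\<lambda>Q. {t \<in> {..<m} \<rightarrow>\<^sub>E {..<11}. j \<in> fibre (c = 0) (c \<in> Q) (t c)}"
  let ?Qs = "{Q. Q \<subseteq> {..<m} \<and> card Q = h}"
  have fin: "finite ?Qs" by (rule finite_subset[of _ "Pow {..<m}"]) auto
  have "{S\<in>\<S>. (c, j) \<in> S} = (\<lambda>(Q, t). wave Q t) ` (SIGMA Q:?Qs. ?T Q)"
    using c by (auto simp: \<S>_def params_def wave_def)
  moreover have "inj_on (\<lambda>(Q, t). wave Q t) (SIGMA Q:?Qs. ?T Q)"
    by (rule inj_on_subset[OF inj_wave]) (auto simp: params_def)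
  ultimately have "card {S\<in>\<S>. (c, j) \<in> S} = card (SIGMA Q:?Qs. ?T Q)"
    by (simp add: card_image)
  also have "\<dots> = (\<Sum>Q\<in>?Qs. card (?T Q))"
    using fin by (intro card_SigmaI) (auto intro!: finite_PiE)
  also have "\<dots> = (\<Sum>Q\<in>?Qs. (if c \<in> Q then 6 else 5) * 11 ^ (m - 1))"
  proof (intro sum.cong refl)
    fix Q
    let ?X = "{t\<in>{..<11}. j \<in> fibre (c = 0) (c \<in> Q) t}"
    have "?T Q = (\<Pi>\<^sub>E i\<in>{..<m}. if i = c then ?X else {..<11})"
      using c by (auto simp: PiE_def Pi_def split: if_splits)
    then have "card (?T Q) = (\<Prod>i<m. card (if i = c then ?X else {..<11}))"
      by (simp add: card_PiE)
    also have "\<dots> = card ?X * (\<Prod>i\<in>{..<m} - {c}. card {..<11::nat})"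
      using c by (subst prod.remove[of _ c]) (auto intro!: prod.cong)
    finally show "card (?T Q) = (if c \<in> Q then 6 else 5) * 11 ^ (m - 1)"
      unfolding card_fibre_index[OF j] using c by simp
  qed
  finally show ?thesis .
qed

text \<open>Transposing the points \<open>c\<close> and \<open>d\<close> permutes the
  \<open>h\<close>-subsets and matches the two sums.\<close>

lemma S_regular:
  assumes u: "u \<in> V" and v: "v \<in> V"
  shows "card {S\<in>\<S>. u \<in> S} = card {S\<in>\<S>. v \<in> S}"
proof -
  obtain c j d i where uv: "u = (c, j)" "v = (d, i)" and c: "c < m" "j < 11" and d: "d < m" "i < 11"
    using u v by (auto simp: V_def)
  let ?Qs = "{Q. Q \<subseteq> {..<m} \<and> card Q = h}"
  have "(\<Sum>Q\<in>?Qs. (if c \<in> Q then 6 else 5) * 11 ^ (m - 1)) =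
        (\<Sum>Q\<in>?Qs. (if d \<in> Q then 6 else 5) * 11 ^ (m - 1 :: nat) :: nat)"
  proof (rule sum.reindex_bij_witness[of _ "(`) (Transposition.transpose c d)" "(`) (Transposition.transpose c d)"])
    fix Q assume Q: "Q \<in> ?Qs"
    show "Transposition.transpose c d ` Transposition.transpose c d ` Q = Q" "Transposition.transpose c d ` Transposition.transpose c d ` Q = Q"
      by (simp_all add: image_image)
    have "Transposition.transpose c d ` Q \<subseteq> {..<m}" using Q c d by (auto simp: Transposition.transpose_def)
    moreover have "card (Transposition.transpose c d ` Q) = card Q" by (intro card_image) auto
    ultimately show "Transposition.transpose c d ` Q \<in> ?Qs" "Transposition.transpose c d ` Q \<in> ?Qs" using Q by auto
    have "d \<in> Transposition.transpose c d ` Q \<longleftrightarrow> c \<in> Q" by (auto simp: Transposition.transpose_def image_iff)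
    then show "(if d \<in> Transposition.transpose c d ` Q then 6 else 5) * 11 ^ (m - 1) =
        ((if c \<in> Q then 6 else 5) * 11 ^ (m - 1) :: nat)" by simp
  qed
  then show ?thesis using c d by (simp add: uv card_params_through)
qed

lemma block_card: "l \<in> \<L> \<Longrightarrow> t < 11 \<Longrightarrow> card (block l t) = 5 * (q + 1)"
  by (simp add: block_def card_cartesian_product L_card card_fibre)

lemma card_V: "card V = 2 * (11 * h + 5) + 1"
  unfolding V_def card_cartesian_product using h by simp

sublocale coalition_system V \<B> \<S> "11 * h + 5"
proof
  show "finite V" by (simp add: V_def)
  show "card V = 2 * (11 * h + 5) + 1" by (rule card_V)
next
  fix B assume "B \<in> \<B>"
  then obtain l t where B: "B = block l t" "l \<in> \<L>" "t < 11" by (auto simp: \<B>_def)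
  show "B \<subseteq> V" using L_sub[OF B(2)] fibre_sub by (auto simp: B block_def V_def subset_iff)
  have "2 * (5 * (q + 1)) < 2 * (11 * h + 5)"
  proof -
    have "q ^ 2 \<ge> 2 * q" using q_gt_1 by (simp add: power2_eq_square)
    moreover have "2 * h = q ^ 2 + q" using m h by simp
    ultimately show ?thesis using q_gt_1 by simp
  qed
  then show "card B < 11 * h + 5" using block_card B by simp
  fix B' assume "B' \<in> \<B>"
  then obtain l' t' where B': "B' = block l' t'" "l' \<in> \<L>" "t' < 11" by (auto simp: \<B>_def)
  show "B \<inter> B' \<noteq> {}"
    using L_inter[OF B(2) B'(2)] fibre_special_inter[OF B(3) B'(3), of False False]
    unfolding B B' block_def by (simp add: Times_Int_Times)
next
  fix u v assume u: "u \<in> V" and v: "v \<in> V"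
  obtain c j d i where uv: "u = (c, j)" "v = (d, i)" and c: "c < m" "j < 11" and d: "d < m" "i < 11"
    using u v by (auto simp: V_def)
  obtain g where g: "bij_betw g {..<m} {..<m}" "g c = d" "\<forall>l\<in>\<L>. g ` l \<in> \<L>"
    using L_trans[OF c(1) d(1)] by blast
  \<comment> \<open>The summand 11 keeps the natural-number subtraction from truncating.\<close>
  define s where "s = 11 + i - j"
  have js: "(j + s) mod 11 = i" using c d by (simp add: s_def)
  have "inj_on (\<lambda>y. (y + s) mod 11) {..<11}"
  proof (rule inj_onI)
    fix x y :: nat
    assume "x \<in> {..<11}" "y \<in> {..<11}" "(x + s) mod 11 = (y + s) mod 11"
    then show "x = y"
      using cong_add_rcancel_nat[of x s y 11] cong_less_modulus_unique_nat[of x y 11]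
      by (simp add: Cong.cong_def)
  qed
  then have shift: "bij_betw (\<lambda>y. (y + s) mod 11) {..<11} {..<11}"
    unfolding bij_betw_def by (intro conjI endo_inj_surj) auto
  show "\<exists>g. bij_betw g V V \<and> g u = v \<and> (\<forall>B\<in>\<B>. g ` B \<in> \<B>)"
  proof (intro exI[of _ "map_prod g (\<lambda>y. (y + s) mod 11)"] conjI ballI)
    show "bij_betw (map_prod g (\<lambda>y. (y + s) mod 11)) V V"
      unfolding V_def by (rule bij_betw_map_prod[OF g(1) shift])
    show "map_prod g (\<lambda>y. (y + s) mod 11) u = v" by (simp add: uv g js)
    fix B assume "B \<in> \<B>"
    then obtain l t where B: "B = block l t" "l \<in> \<L>" "t < 11" by (auto simp: \<B>_def)
    have "map_prod g (\<lambda>y. (y + s) mod 11) ` B = block (g ` l) ((t + s) mod 11)"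
      unfolding B block_def by (rule map_prod_surj_on[OF refl fibre_shift])
    then show "map_prod g (\<lambda>y. (y + s) mod 11) ` B \<in> \<B>"
      using g(3) B(2) unfolding \<B>_def by (auto intro!: exI[of _ "g ` l"] exI[of _ "(t + s) mod 11"])
  qed
  show "card {S \<in> \<S>. u \<in> S} = card {S \<in> \<S>. v \<in> S}" by (rule S_regular[OF u v])
next
  fix S assume "S \<in> \<S>"
  then obtain Q t where p: "(Q, t) \<in> params" and S: "S = wave Q t" by (rule SE)
  show "S \<subseteq> V" "card S = 11 * h + 5" using p by (simp_all add: S wave_sub card_wave)
  have m0: "0 < m" using h by simp
  {
    fix S' assume "S' \<in> \<S>"
    then obtain Q' t' where p': "(Q', t') \<in> params" and S': "S' = wave Q' t'" by (rule SE)
    \<comment> \<open>Any two waves already meet over the special point, whatever their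
      parameters.\<close>
    obtain x where "x \<in> fibre True (0 \<in> Q) (t 0)" "x \<in> fibre True (0 \<in> Q') (t' 0)"
      using fibre_special_inter[OF params_less[OF p m0] params_less[OF p' m0]] by blast
    then have "(0, x) \<in> S \<inter> S'" using m0 by (simp add: S S' wave_def)
    then show "S \<inter> S' \<noteq> {}" by blast
  }
  fix B assume "B \<in> \<B>"
  then obtain l s where B: "B = block l s" "l \<in> \<L>" "s < 11" by (auto simp: \<B>_def)
  \<comment> \<open>A line has at least three points, hence one that is not special; there the wave
    is an interval, which the block both meets and leaves.\<close>
  have "\<not> l \<subseteq> {0}"
    using card_mono[of "{0}" l] L_card[OF B(2)] q_gt_1 by auto
  then obtain c where c: "c \<in> l" "c \<noteq> 0" by auto
  then have cm: "c < m" using L_sub[OF B(2)] by auto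
  note neutral = fibre_ordinary_neutral[OF B(3) params_less[OF p cm], of "c \<in> Q"]
  obtain x y where "x \<in> fibre True False s - fibre False (c \<in> Q) (t c)"
      "y \<in> fibre True False s \<inter> fibre False (c \<in> Q) (t c)"
    using neutral by blast
  then have "(c, x) \<in> B - S" "(c, y) \<in> B \<inter> S"
    using c cm by (auto simp: B S block_def wave_def)
  then show "B - S \<noteq> {} \<and> B \<inter> S \<noteq> {}" by blast
qed

text \<open>An exchange removes \<open>j\<close> from the special fibre and adds at most one
  element. With equal sizes, distinct translates differ too much; going from six to five would put a
  translate of the squares inside the six-element shape; going from five to six would need
  growth.\<close>

lemma not_exchangeable_special: "\<not> exchangeable (0, j)"
proof
  assume "exchangeable (0, j)"
  then obtain S w where S: "S \<in> \<S>" "w \<in> V - S" "(0, j) \<in> S" and S': "insert w (S - {(0, j)}) \<in> \<S>"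
    unfolding exchangeable_def by blast
  obtain Q t where p: "(Q, t) \<in> params" and Seq: "S = wave Q t" using S(1) by (rule SE)
  obtain Q' t' where p': "(Q', t') \<in> params" and S'eq: "insert w (S - {(0, j)}) = wave Q' t'"
    using S' by (rule SE)
  have m0: "0 < m" using h by simp
  note t = params_less[OF p m0] params_less[OF p' m0]
  let ?F = "fibre True (0 \<in> Q) (t 0)" and ?F' = "fibre True (0 \<in> Q') (t' 0)"
  have F: "?F = {y. (0, y) \<in> S}" and F': "?F' = {y. (0, y) \<in> insert w (S - {(0, j)})}"
    using wave_fibre[OF m0, of Q t] wave_fibre[OF m0, of Q' t'] Seq S'eq by simp_all
  have j: "j \<in> ?F" using F S by simp
  have jw: "(0, j) \<noteq> w" using S by auto
  then have j': "j \<notin> ?F'" using F' by auto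
  have sub: "?F' - ?F \<subseteq> {snd w}" "fst w \<noteq> 0 \<Longrightarrow> ?F' \<subseteq> ?F" "fst w = 0 \<Longrightarrow> ?F' = insert (snd w) (?F - {j}) \<and> snd w \<notin> ?F"
    using F F' S(2) by (cases w; force)+
  have le: "card (?F' - ?F) \<le> 1" using card_mono[OF _ sub(1)] by simp
  consider "(0 \<in> Q) = (0 \<in> Q')" | "0 \<in> Q" "0 \<notin> Q'" | "0 \<notin> Q" "0 \<in> Q'" by blast
  then show False
  proof cases
    case 1
    then have "t 0 = t' 0"
      using fibre_special_diff[OF t(2,1), of "0 \<in> Q"] le by (cases "t 0 = t' 0") auto
    then show False using 1 j j' by simp
  next
    case 2
    have "fst w = 0" using fibre_special_not_subset[OF t(2,1)] sub(2) 2 by auto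
    then have "card ?F' = card ?F" using sub(3) j finite_fibre by (metis card_Suc_Diff1 card_insert_disjoint finite_Diff Diff_iff)
    then show False using 2 t by (simp add: card_fibre)
  next
    case 3
    have "card ?F' \<le> card ?F"
    proof (cases "fst w = 0")
      case True
      then have "card ?F' = card ?F" using sub(3) j finite_fibre by (metis card_Suc_Diff1 card_insert_disjoint finite_Diff Diff_iff)
      then show ?thesis by simp
    qed (use sub(2) finite_fibre card_mono in blast)
    then show False using 3 t by (simp add: card_fibre)
  qed
qed

text \<open>Rotating an interval of length five by one step replaces its first element by the next
  one.\<close>

lemma exchangeable_ordinary: "exchangeable (1, 0)"
proof -
  \<comment> \<open>These are \<open>h\<close> points avoiding 1, so that the fibre over 1 has five
    elements; they fit below \<open>m = 2 * h + 1\<close> because \<open>h \<ge> 1\<close>.\<close>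
  define Q where "Q = {2..<h + 2}"
  have Q: "Q \<subseteq> {..<m}" "card Q = h" "1 \<notin> Q" using h h_pos by (auto simp: Q_def)
  define t where "t = (\<lambda>c\<in>{..<m}. 0 :: nat)"
  have m1: "1 < m" using h h_pos by simp
  have p: "(Q, t) \<in> params" "(Q, t(1 := 1)) \<in> params"
    using Q m1 by (auto simp: params_def t_def PiE_def extensional_def Pi_def)
  have "wave Q (t(1 := 1)) = insert (1, 5) (wave Q t - {(1, 0)})"
  proof -
    have "(c, x) \<in> wave Q (t(1 := 1)) \<longleftrightarrow> (c, x) \<in> insert (1, 5) (wave Q t - {(1, 0)})" for c x
      using Q(3) m1 fibre_ordinary_step by (cases "c = 1") (auto simp: wave_def t_def)
    then show ?thesis by auto
  qed
  moreover have "(1, 0) \<in> wave Q t" "(1, 5) \<in> V - wave Q t"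
    using Q(3) m1 by (auto simp: wave_def t_def fibre_ordinary_0 V_def)
  moreover have "wave Q t \<in> \<S>" "wave Q (t(1 := 1)) \<in> \<S>"
    using p by (auto simp: \<S>_def)
  ultimately show ?thesis
    unfolding exchangeable_def by metis
qed

end

section \<open>Transfer to the voters \<open>{1..n}\<close> and numerical bounds\<close>

lemma (in coalition_system) unbiased_rule_exists:
  assumes f: "bij_betw f {1..n} V"
    and B: "B \<in> \<B>" "card B \<le> s" "s \<le> n"
    and u: "u \<in> V" "exchangeable u" and v: "v \<in> V" "\<not> exchangeable v"
  shows "\<exists>\<Phi>. voting_rule n \<Phi> \<and> odd_rule n \<Phi> \<and> monotone_rule n \<Phi> \<and> unbiased n \<Phi> \<and>
    \<not> transitive_symmetric n \<Phi> \<and> (\<exists>S. winning_coalition n \<Phi> S \<and> card S = s)"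
proof -
  define \<W> where win_def: "\<W> = {T. T \<subseteq> {1..n} \<and> f ` T \<in> W}"
  have inj: "inj_on f {1..n}" and im: "f ` {1..n} = V" using f by (auto simp: bij_betw_def)
  have pre: "\<exists>S\<subseteq>{1..n}. T = f ` S" if "T \<subseteq> V" for T
    using that unfolding im[symmetric] by (rule subset_imageE) blast
  have win_sub: "S \<subseteq> {1..n}" if "S \<in> \<W>" for S
    using that by (simp add: win_def)
  have up: "T \<in> \<W>" if "S \<in> \<W>" "S \<subseteq> T" "T \<subseteq> {1..n}" for S T
    using that W_up[of "f ` S" "f ` T"] image_mono[of T "{1..n}" f] im
    by (auto simp only: win_def mem_Collect_eq image_mono)
  have odd: "{1..n} - S \<in> \<W> \<longleftrightarrow> S \<notin> \<W>" if S: "S \<subseteq> {1..n}" for S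
  proof -
    have "f ` ({1..n} - S) = V - f ` S"
      using inj_on_image_set_diff[OF inj, of "{1..n}" S] S im by auto
    moreover have "f ` S \<subseteq> V" using S im by blast
    ultimately show ?thesis using S W_compl by (auto simp only: win_def mem_Collect_eq)
  qed
  have level: "card {S\<in>\<W>. card S = j \<and> i \<in> S} = card {T\<in>W. card T = j \<and> f i \<in> T}"
    if i: "i \<in> {1..n}" for i j
  proof (rule bij_betw_same_card[where f = "(`) f"])
    have c: "card (f ` S) = card S" if "S \<subseteq> {1..n}" for S
      using that inj by (meson card_image inj_on_subset)
    have e: "f i \<in> f ` S \<longleftrightarrow> i \<in> S" if "S \<subseteq> {1..n}" for S
      using that i inj by (meson inj_on_image_mem_iff)
    show "bij_betw ((`) f) {S\<in>\<W>. card S = j \<and> i \<in> S} {T\<in>W. card T = j \<and> f i \<in> T}"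
      unfolding bij_betw_def
    proof (intro conjI equalityI subsetI)
      show "inj_on ((`) f) {S\<in>\<W>. card S = j \<and> i \<in> S}"
        using inj_on_image_Pow[OF inj] by (rule inj_on_subset) (auto simp: win_def)
      fix T assume "T \<in> (`) f ` {S\<in>\<W>. card S = j \<and> i \<in> S}"
      then show "T \<in> {T\<in>W. card T = j \<and> f i \<in> T}"
        using c e by (auto simp: win_def)
    next
      fix T assume T: "T \<in> {T\<in>W. card T = j \<and> f i \<in> T}"
      then obtain S where S: "S \<subseteq> {1..n}" "T = f ` S" using pre W_sub by blast
      then show "T \<in> (`) f ` {S\<in>\<W>. card S = j \<and> i \<in> S}"
        using T c[OF S(1)] e[OF S(1)] by (intro image_eqI[of _ _ S]) (simp_all add: win_def)
    qed
  qed
  have "\<not> transitive_symmetric n (family_rule n \<W>)"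
  proof
    assume trans: "transitive_symmetric n (family_rule n \<W>)"
    obtain a b where a: "a \<in> {1..n}" "f a = u" and b: "b \<in> {1..n}" "f b = v"
      using u(1) v(1) unfolding im[symmetric] by blast
    obtain \<rho> where \<rho>: "\<rho> \<in> aut n (family_rule n \<W>)" and ab: "\<rho> a = b"
      using trans a b unfolding transitive_symmetric_def by blast
    have perm: "bij_betw \<rho> {1..n} {1..n}"
      using \<rho> by (intro permutes_imp_bij) (simp add: aut_def)
    let ?g = "inv_into {1..n} f"
    \<comment> \<open>An automorphism of the rule is conjugated by \<open>f\<close> into an
      automorphism of \<open>W\<close>, to which the invariance of \<open>exchangeable\<close>
      applies.\<close>
    define \<tau> where "\<tau> = f \<circ> (\<rho> \<circ> ?g)"
    have g: "?g (f i) = i" if "i \<in> {1..n}" for i using that inj by simp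
    have bij: "bij_betw \<tau> V V"
      unfolding \<tau>_def using bij_betw_trans[OF bij_betw_trans[OF bij_betw_inv_into[OF f] perm] f] .
    have "\<tau> ` T \<in> W \<longleftrightarrow> T \<in> W" if T: "T \<subseteq> V" for T
    proof -
      obtain S where S: "S \<subseteq> {1..n}" "T = f ` S" using pre[OF T] by blast
      have "\<tau> ` T = f ` \<rho> ` S"
        unfolding S(2) \<tau>_def image_image using S(1) g by (intro image_cong) auto
      moreover have "\<rho> ` S \<subseteq> {1..n}" using S(1) perm by (auto simp: bij_betw_def)
      ultimately show ?thesis using aut_family_rule[OF \<rho> S(1)] S by (simp add: win_def)
    qed
    then have "exchangeable (\<tau> u)" by (intro automorphism_exchangeable[OF bij _ u(2)])
    moreover have "\<tau> u = v" using g[OF a(1)] a b ab by (simp add: \<tau>_def)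
    ultimately show False using v(2) by simp
  qed
  moreover have "unbiased n (family_rule n \<W>)"
  proof (rule family_rule_unbiased[OF win_sub up])
    fix i j k assume ij: "i \<in> {1..n}" "j \<in> {1..n}"
    then have "f i \<in> V" "f j \<in> V" using im by auto
    then show "card {S\<in>\<W>. card S = k \<and> i \<in> S} = card {S\<in>\<W>. card S = k \<and> j \<in> S}"
      unfolding level[OF ij(1)] level[OF ij(2)] by (rule W_regular)
  qed
  moreover have "\<exists>S. winning_coalition n (family_rule n \<W>) S \<and> card S = s"
  proof -
    obtain S where S: "S \<subseteq> {1..n}" "B = f ` S" using pre[OF B_sub[OF B(1)]] by (elim exE conjE) (rule that)
    have "card S = card B" unfolding S(2) using card_image[OF inj_on_subset[OF inj S(1)]] ..
    \<comment> \<open>The size has to be exactly \<open>s\<close>, so the coalition is padded;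
      supersets of winning sets still win.\<close>
    then obtain S' where S': "S \<subseteq> S'" "S' \<subseteq> {1..n}" "card S' = s"
      using exists_subset_between[of S s "{1..n}"] S(1) B(2,3) by (metis card_atLeastAtMost diff_Suc_1 finite_atLeastAtMost)
    have "covers B" using B(1) by (auto simp: covers_def)
    then have "S \<in> \<W>" using covers_imp_W[OF B_sub[OF B(1)]] S by (simp add: win_def)
    then have "winning_coalition n (family_rule n \<W>) S'"
      using S' up[OF _ S'(1,2)] by (intro family_rule_winning_coalition[OF odd up]) simp_all
    then show ?thesis using S' by blast
  qed
  moreover have "odd_rule n (family_rule n \<W>)"
    by (rule family_rule_odd) (rule odd)
  moreover have "monotone_rule n (family_rule n \<W>)"
    by (rule family_rule_monotone) (rule up)
  ultimately show ?thesis
    using family_rule_voting_rule[of n \<W>] by (intro exI[of _ "family_rule n \<W>"] conjI)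
qed

theorem theorem16:
  fixes q m n :: nat
  assumes "primepow q" and "m = q ^ 2 + q + 1" and "n = 11 * m"
  shows "\<exists>\<Phi> :: (nat \<Rightarrow> int) \<Rightarrow> int.
    voting_rule n \<Phi> \<and> odd_rule n \<Phi> \<and> monotone_rule n \<Phi> \<and> unbiased n \<Phi> \<and>
    \<not> transitive_symmetric n \<Phi> \<and>
    (\<exists>S. winning_coalition n \<Phi> S \<and> int (card S) = \<lfloor>1.508 * sqrt (real n)\<rfloor> + 5)"
proof -
  obtain \<L> :: "nat set set" where L: "\<L> \<noteq> {}"
      "\<And>l. l \<in> \<L> \<Longrightarrow> l \<subseteq> {..<m}" "\<And>l. l \<in> \<L> \<Longrightarrow> card l = q + 1"
      "\<And>l l'. l \<in> \<L> \<Longrightarrow> l' \<in> \<L> \<Longrightarrow> l \<inter> l' \<noteq> {}"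
      "\<And>u v. u < m \<Longrightarrow> v < m \<Longrightarrow>
        \<exists>g. bij_betw g {..<m} {..<m} \<and> g u = v \<and> (\<forall>l\<in>\<L>. g ` l \<in> \<L>)"
    using projective_plane[OF assms(1,2)] by blast
  have q: "q > 1" using primepow_gt_Suc_0[OF assms(1)] by simp
  define h where "h = (q ^ 2 + q) div 2"
  \<comment> \<open>Evenness makes the division in \<open>h\<close> exact, so \<open>m\<close> is
    odd.\<close>
  have "even (q ^ 2 + q)" by simp
  then have h: "m = 2 * h + 1" using assms(2) by (simp add: h_def)
  interpret blown_up_plane q m h \<L>
    by (rule blown_up_plane.intro[OF q assms(2) h]) (use L in blast)+
  have q2: "q ^ 2 \<ge> 2 * q" using q by (simp add: power2_eq_square)
  have n77: "n \<ge> 77" using q2 q assms by simp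
  define s where "s = nat \<lfloor>1.508 * sqrt (real n)\<rfloor> + 5"
  have s: "int s = \<lfloor>1.508 * sqrt (real n)\<rfloor> + 5" by (simp add: s_def)
  have lower: "5 * (q + 1) \<le> s"
  proof -
    \<comment> \<open>Here the constant enters: \<open>11 * 1.508^2 = 25.014704\<close>, which
      exceeds 25. The 5 added after rounding covers the remaining part of
      \<open>5 * (q + 1)\<close>.\<close>
    have "(5 * real q)\<^sup>2 \<le> (1.508 * sqrt (real n))\<^sup>2"
      by (simp add: power_mult_distrib assms(2,3) field_simps)
    then have "5 * real q \<le> 1.508 * sqrt (real n)"
      by (rule power2_le_imp_le) simp
    then have "int (5 * q) \<le> \<lfloor>1.508 * sqrt (real n)\<rfloor>"
      by (simp add: le_floor_iff)
    then show ?thesis using s by simp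
  qed
  have upper: "s \<le> n"
  proof -
    have "(1.508 * sqrt (real n))\<^sup>2 \<le> (real n - 5)\<^sup>2"
    proof -
      have "(1.508 * sqrt (real n))\<^sup>2 = 2.274064 * real n"
        by (simp add: power_mult_distrib power2_eq_square)
      \<comment> \<open>The generous factor 67 is at most \<open>n - 10\<close>, as
        \<open>n \<ge> 77\<close>; then \<open>(n - 10) * n\<close> completes to the square of
        \<open>n - 5\<close>.\<close>
      also have "\<dots> \<le> 67 * real n" by simp
      also have "\<dots> \<le> (real n - 10) * real n" using n77 by (intro mult_right_mono) auto
      also have "\<dots> \<le> (real n - 10) * real n + 25" by simp
      also have "\<dots> = (real n - 5)\<^sup>2" by (simp add: power2_eq_square algebra_simps)
      finally show ?thesis .
    qed
    then have "1.508 * sqrt (real n) \<le> real n - 5"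
      by (rule power2_le_imp_le) (use n77 in simp)
    then have "of_int \<lfloor>1.508 * sqrt (real n)\<rfloor> \<le> real n - 5"
      using of_int_floor_le order_trans by blast
    then have "\<lfloor>1.508 * sqrt (real n)\<rfloor> \<le> int n - 5" by linarith
    then show ?thesis using s by simp
  qed
  have "card {1..n} = card V" by (simp add: V_def card_cartesian_product assms(3))
  then obtain f where f: "bij_betw f {1..n} V"
    using finite_same_card_bij[OF finite_atLeastAtMost finite_V] by blast
  obtain l where l: "l \<in> \<L>" using L(1) by blast
  then have B: "block l 0 \<in> \<B>" "card (block l 0) \<le> s"
    using lower block_card[of l 0] by (auto simp: \<B>_def intro!: exI[of _ l] exI[of _ "0 :: nat"])
  have m1: "m > 1" using assms(2) q by simp
  then have "(1, 0) \<in> V" "(0, 0) \<in> V" by (auto simp: V_def)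
  from unbiased_rule_exists[OF f B upper this(1) exchangeable_ordinary this(2) not_exchangeable_special]
  show ?thesis unfolding s[symmetric] by simp
qed

end
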